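(* Let $K$ be a field, let $P_n=\{p_1,\dots,p_n\}$ ($n\ge 1$) be a finite poset with $n$ elements such that $p_i\le p_j$ implies $i\le j$, and let $G=G(P_n)$. For $F\subset[n]$ let $H_{\bar A(G_F)}(z)$ be the Hilbert series of the basic cover algebra $\bar A(G_F)$ (with the convention $H_{\bar A(G_\emptyset)}(z)=\frac{1}{1-z}$), and let $H_{A(G)}(z)$ be the Hilbert series of the vertex cover algebra $A(G)$. Then $$H_{A(G)}(z)=\frac{1}{(1-z)^{n}}\sum_{F\subset[n]}H_{\bar A(G_F)}(z)\left(\frac{z}{1-z}\right)^{n-|F|}.$$ In particular, if $h(z)=\sum_{j\ge0}h_jz^j$ and $h^F(z)=\sum_{j\ge0}h^F_jz^j$, where $h=(h_j)_{j\ge0}$ and $h^F=(h_j^F)_{j\ge0}$ are the $h$-vectors of $A(G)$ and $\bar A(G_F)$ respectively, then $$h(z)=\sum_{F\subset[n]}h^F(z)\,z^{n-|F|}.$$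
   Context: $[n]=\{1,\dots,n\}$; $F\subset[n]$ ranges over all subsets, including $\emptyset$ and $[n]$. For a poset $Q=\{q_1,\dots,q_m\}$, $G(Q)$ is the bipartite graph on $\{x_1,\dots,x_m\}\cup\{y_1,\dots,y_m\}$ whose edges are all $\{x_i,y_j\}$ with $q_i\le q_j$. For $\emptyset\ne F\subset[n]$, $P_n(F)$ is the subposet of $P_n$ induced on $\{p_i\mid i\in F\}$ and $G_F=G(P_n(F))$ (with the elements of $P_n(F)$ indexed by $F$). For such a graph $G$ with $2m$ vertices let $S=K[x_1,\dots,x_m,y_1,\dots,y_m]$, with maximal graded ideal $\mathfrak m$. A $k$-vertex cover ($k\in\mathbb N$, $0 \in \mathbb N$) is a vector $c\in\mathbb N^{2m}$, indexed by the vertices, with $c(v)+c(w)\ge k$ for every edge $\{v,w\}$. The vertex cover algebra $A(G)$ is the subalgebra of $S[t]$ generated over $K$ by all monomials $x_1^{c_1}\cdots x_m^{c_m}y_1^{c_{m+1}}\cdots y_m^{c_{2m}}t^k$ with $c$ a $k$-vertex cover, $k\in\mathbb N$. It is known that $A(G)=\bigoplus_{k\ge0}I_G^kt^k$, where the cover ideal $I_G\subset S$ is minimally generated by the monomials $m_C=\prod_{v\in C}v$, $C$ a minimal vertex cover of $G$, and that each such $C$ has exactly $m$ elements. $A(G)$ is a standard graded $K$-algebra by giving degree $1$ to each $x_i$, each $y_j$ and each $m_Ct$. The basic cover algebra is $\bar A(G)=A(G)/\mathfrak mA(G)$ with the induced grading, a standard graded $K$-algebra generated by the classes of the $m_Ct$.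 The $h$-vector of a standard graded algebra of Krull dimension $d$ with Hilbert series $h(z)/(1-z)^d$ is the coefficient sequence of the polynomial $h(z)$. Here $\dim A(G)=2n+1$ and $\dim\bar A(G_F)=|F|+1$; by the convention for $F=\emptyset$, $h^\emptyset(z)=1$. *)

theory Defs
  imports
    "HOL-Algebra.Embedded_Algebras"
    "HOL-Algebra.Generated_Rings"
    "HOL-Algebra.QuotRing"
    "HOL-Algebra.Algebraic_Closure_Type"
    "HOL-Computational_Algebra.Formal_Power_Series"
    "HOL-Computational_Algebra.Polynomial_FPS"
    "HOL-Library.Poly_Mapping"
    "HOL-Library.Extended_Nat"
begin

section \<open>Graded algebras, Hilbert series, h-polynomials\<close>

text \<open>
  Algebras over a field are rings \<open>R\<close> together with a subfield \<open>K\<close> of \<open>R\<close>; linear algebra over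
  \<open>K\<close> is that of the theory Embedded Algebras.

  If \<open>R\<close> is graded by giving degree 1 to the elements of a generating set \<open>Gs\<close>, then its component
  of degree \<open>d\<close> is the \<open>K\<close>-span of all products of \<open>d\<close> elements of \<open>Gs\<close>.  Since spans are only
  available for lists, it is written as the (directed) union of the spans of finitely many products.
\<close>

definition degree_products :: "('a, 'b) ring_scheme \<Rightarrow> 'a set \<Rightarrow> nat \<Rightarrow> 'a set" where
  "degree_products R Gs d =
     {foldr (\<otimes>\<^bsub>R\<^esub>) gs \<one>\<^bsub>R\<^esub> | gs. set gs \<subseteq> Gs \<and> length gs = d}"

definition graded_component :: "('a, 'b) ring_scheme \<Rightarrow> 'a set \<Rightarrow> 'a set \<Rightarrow> nat \<Rightarrow> 'a set" where
  "graded_component R K Gs d =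
     (\<Union>Us \<in> {Us. set Us \<subseteq> degree_products R Gs d}. ring.Span R K Us)"

definition hilbert_series :: "('a, 'b) ring_scheme \<Rightarrow> 'a set \<Rightarrow> (nat \<Rightarrow> 'a set) \<Rightarrow> rat fps" where
  "hilbert_series R K V = Abs_fps (\<lambda>d. of_nat (ring.dim R K (V d)))"

definition krull_dim :: "('a, 'b) ring_scheme \<Rightarrow> enat" where
  "krull_dim R = Sup {enat k | k. \<exists>P. (\<forall>i\<le>k. primeideal (P i) R) \<and> (\<forall>i<k. P i \<subset> P (Suc i))}"

text \<open>
  The coefficient sequence of the polynomial \<open>h\<close> is the h-vector of a standard graded algebra \<open>R\<close>
  with Hilbert series \<open>H\<close>.  Such an \<open>h\<close> is unique if it exists.
\<close>

definition is_h_polynomial :: "('a, 'b) ring_scheme \<Rightarrow> rat fps \<Rightarrow> rat poly \<Rightarrow> bool" where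
  "is_h_polynomial R H h \<longleftrightarrow>
     (\<exists>d. krull_dim R = enat d \<and> H = fps_of_poly h / (1 - fps_X) ^ d)"


section \<open>Bipartite graphs of posets and vertex covers\<close>

datatype vertex = VX nat | VY nat

type_synonym graph = "vertex set \<times> vertex set set"

text \<open>
  The poset \<open>{p i | i \<in> F}\<close>, indexed by \<open>F\<close>, with the order induced by \<open>r\<close>;
  \<open>(a, b) \<in> r\<close> means \<open>a \<le> b\<close>.
\<close>

definition poset_graph :: "(nat \<Rightarrow> 'a) \<Rightarrow> 'a rel \<Rightarrow> nat set \<Rightarrow> graph" where
  "poset_graph p r F =
     (VX ` F \<union> VY ` F, {{VX i, VY j} | i j. i \<in> F \<and> j \<in> F \<and> (p i, p j) \<in> r})"

definition is_k_cover :: "graph \<Rightarrow> nat \<Rightarrow> (vertex \<Rightarrow>\<^sub>0 nat) \<Rightarrow> bool" where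
  "is_k_cover G k c \<longleftrightarrow> Poly_Mapping.keys c \<subseteq> fst G \<and>
     (\<forall>v w. {v, w} \<in> snd G \<longrightarrow> k \<le> Poly_Mapping.lookup c v + Poly_Mapping.lookup c w)"

definition vertex_cover :: "graph \<Rightarrow> vertex set \<Rightarrow> bool" where
  "vertex_cover G C \<longleftrightarrow> C \<subseteq> fst G \<and> (\<forall>e\<in>snd G. e \<inter> C \<noteq> {})"

definition minimal_vertex_cover :: "graph \<Rightarrow> vertex set \<Rightarrow> bool" where
  "minimal_vertex_cover G C \<longleftrightarrow> vertex_cover G C \<and> (\<forall>D. D \<subset> C \<longrightarrow> \<not> vertex_cover G D)"


section \<open>Vertex cover algebras and basic cover algebras\<close>

text \<open>
  \<open>'k mpoly\<close> is the polynomial ring over \<open>'k\<close> in all the variables \<open>VX i\<close>, \<open>VY i\<close> (\<open>i\<close> any natural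
  number), and \<open>'k mpoly poly\<close> adjoins the further variable \<open>t\<close>.  The algebras of a graph live in
  this ring; only monomials in the vertices of the graph enter their definition.
\<close>

type_synonym 'k mpoly = "(vertex \<Rightarrow>\<^sub>0 nat) \<Rightarrow>\<^sub>0 'k"

definition ambient :: "'k::field mpoly poly ring" where
  "ambient = ring_of_type_algebra"

definition scalars :: "'k::field mpoly poly set" where
  "scalars = range (\<lambda>a. [:Poly_Mapping.single 0 a:])"

definition cover_monomial :: "(vertex \<Rightarrow>\<^sub>0 nat) \<Rightarrow> nat \<Rightarrow> 'k::field mpoly poly" where
  "cover_monomial c k = Polynomial.monom (Poly_Mapping.single c 1) k"

definition var :: "vertex \<Rightarrow> 'k::field mpoly" where
  "var v = Poly_Mapping.single (Poly_Mapping.single v 1) 1"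

definition vertex_cover_algebra :: "graph \<Rightarrow> 'k::field mpoly poly ring" where
  "vertex_cover_algebra G = ambient
     \<lparr>carrier := generate_ring ambient (scalars \<union> {cover_monomial c k | c k. is_k_cover G k c})\<rparr>"

text \<open>The variables \<open>v\<close> and the elements \<open>m\<^sub>C t\<close>.\<close>

definition degree_one_generators :: "graph \<Rightarrow> 'k::field mpoly poly set" where
  "degree_one_generators G = {[:var v:] | v. v \<in> fst G} \<union>
     {Polynomial.monom (\<Prod>v\<in>C. var v) 1 | C. minimal_vertex_cover G C}"

definition cover_algebra_component :: "graph \<Rightarrow> nat \<Rightarrow> 'k::field mpoly poly set" where
  "cover_algebra_component G =
     graded_component (vertex_cover_algebra G) scalars (degree_one_generators G)"

text \<open>The extension to the vertex cover algebra of the maximal graded ideal, which is generated by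
  the variables.\<close>

definition irrelevant_extension :: "graph \<Rightarrow> 'k::field mpoly poly set" where
  "irrelevant_extension G = Idl\<^bsub>vertex_cover_algebra G\<^esub> {[:var v:] | v. v \<in> fst G}"

definition basic_cover_algebra :: "graph \<Rightarrow> 'k::field mpoly poly set ring" where
  "basic_cover_algebra G = vertex_cover_algebra G Quot irrelevant_extension G"

definition residue_class :: "graph \<Rightarrow> 'k::field mpoly poly \<Rightarrow> 'k mpoly poly set" where
  "residue_class G a = irrelevant_extension G +>\<^bsub>vertex_cover_algebra G\<^esub> a"

text \<open>The field \<open>'k\<close> is passed as a type argument.\<close>

definition hilbert_A :: "'k::field itself \<Rightarrow> graph \<Rightarrow> rat fps" where
  "hilbert_A K G = hilbert_series (vertex_cover_algebra G) (scalars :: 'k mpoly poly set)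
     (cover_algebra_component G)"

definition h_polynomial_A :: "'k::field itself \<Rightarrow> graph \<Rightarrow> rat poly \<Rightarrow> bool" where
  "h_polynomial_A K G h \<longleftrightarrow>
     is_h_polynomial (vertex_cover_algebra G :: 'k mpoly poly ring) (hilbert_A K G) h"

text \<open>
  For the basic cover algebra of the subposet indexed by \<open>F\<close>, the scalars and the (induced) grading
  are the images of those of the vertex cover algebra.  The case \<open>F = {}\<close> is by convention.
\<close>

definition hilbert_basic ::
  "'k::field itself \<Rightarrow> (nat \<Rightarrow> 'a) \<Rightarrow> 'a rel \<Rightarrow> nat set \<Rightarrow> rat fps" where
  "hilbert_basic K p r F =
     (if F = {} then 1 / (1 - fps_X)
      else let G = poset_graph p r F in
        hilbert_series (basic_cover_algebra G)
          (residue_class G ` (scalars :: 'k mpoly poly set))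
          (\<lambda>d. residue_class G ` cover_algebra_component G d))"

definition h_polynomial_basic ::
  "'k::field itself \<Rightarrow> (nat \<Rightarrow> 'a) \<Rightarrow> 'a rel \<Rightarrow> nat set \<Rightarrow> rat poly \<Rightarrow> bool" where
  "h_polynomial_basic K p r F h \<longleftrightarrow>
     (if F = {} then h = 1
      else is_h_polynomial
        (basic_cover_algebra (poset_graph p r F) :: 'k mpoly poly set ring)
        (hilbert_basic K p r F) h)"

end

theory Submission
  imports Defs "HOL-Library.Product_Plus"
begin

text \<open>
  \<open>A(G)\<close> is spanned by the monomials \<open>x\<^sup>a y\<^sup>b t\<^sup>k\<close> with \<open>(a, b)\<close> a \<open>k\<close>-cover, that is, \<open>a\<^sub>i + b\<^sub>j \<ge> k\<close> whenever
  \<open>p\<^sub>i \<le> p\<^sub>j\<close>; such a monomial has degree \<open>k + (\<Sum>i. a\<^sub>i + b\<^sub>i - k)\<close>.  In the basic cover algebra exactly the tight covers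
  survive, those with \<open>a\<^sub>i + b\<^sub>i = k\<close> for all \<open>i\<close>; they are the order-reversing maps \<open>a\<close> into \<open>{0..k}\<close>.

  Given a \<open>k\<close>-cover, let \<open>m\<^sub>i\<close> be the minimum of \<open>k\<close> and all \<open>a\<^sub>j\<close> with \<open>p\<^sub>j \<le> p\<^sub>i\<close>, and let \<open>F\<close> be the set of all \<open>i\<close> with
  \<open>a\<^sub>i = m\<^sub>i\<close>.  The map \<open>m\<close> is determined by its restriction to \<open>F\<close>, which is an arbitrary order-reversing map
  on \<open>F\<close>; the differences \<open>a\<^sub>i - m\<^sub>i\<close> (\<open>i \<notin> F\<close>) are arbitrary positive numbers, and the differences \<open>b\<^sub>i - (k - m\<^sub>i)\<close> (all \<open>i\<close>)
  are arbitrary natural numbers.  Summing over \<open>F\<close> gives the formula for the Hilbert series.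

  The Krull dimensions, which enter the definition of the h-vectors, are bounded above by the growth of a
  filtration: for a chain of primes of length \<open>d\<close> there are elements of which the monomials with exponents below \<open>N\<close>
  are \<open>N\<^sup>d\<close> linearly independent elements.  They are bounded below by a flag of faces of the
  cone of covers, since the monomials outside a face span a prime ideal.
\<close>

section \<open>Krull dimension and growth\<close>

text \<open>For an ideal \<open>P\<close> this is linear independence of the residues of
  \<open>Us\<close> modulo \<open>P\<close>. The lengths must agree because \<open>combine\<close>
  stops at the end of the shorter list, so surplus coefficients would be unconstrained.\<close>

definition (in ring) independent_modulo :: "'a set \<Rightarrow> 'a set \<Rightarrow> 'a list \<Rightarrow> bool" where
  "independent_modulo K P Us \<longleftrightarrow> set Us \<subseteq> carrier R \<and>
     (\<forall>Ks. set Ks \<subseteq> K \<and> length Ks = length Us \<and> combine Ks Us \<in> P \<longrightarrow> set Ks \<subseteq> {\<zero>})"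

lemma (in ring) independent_modulo_imp_independent:
  assumes K: "subfield K R" and Us: "independent_modulo K P Us" and "\<zero> \<in> P"
  shows "independent K Us"
proof (rule trivial_combine_imp_independent[OF K])
  show c: "set Us \<subseteq> carrier R"
    using Us unfolding independent_modulo_def by auto
  fix Ks assume Ks: "set Ks \<subseteq> K" "combine Ks Us = \<zero>"
  have KR: "set Ks \<subseteq> carrier R"
    using subfieldE(3)[OF K] Ks(1) by auto
  have 0: "\<zero> \<in> K"
    using subringE(2)[OF subfieldE(1)[OF K]] .
  \<comment> \<open>\<open>combine_normalize\<close> pads or cuts the coefficients to the length of
    \<open>Us\<close>, as \<open>independent_modulo\<close> demands; the padding consists of zeros
    only.\<close>
  obtain Ks' where Ks': "set (take (length Us) Ks) \<subseteq> set Ks'"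
      "set Ks' \<subseteq> set (take (length Us) Ks) \<union> {\<zero>}" "length Ks' = length Us" "combine Ks' Us = \<zero>"
    using combine_normalize[OF KR c Ks(2)] .
  have "set (take (length Us) Ks) \<subseteq> K"
    using set_take_subset Ks(1) by fast
  then have "set Ks' \<subseteq> K"
    using Ks'(2) 0 by blast
  then have "set Ks' \<subseteq> {\<zero>}"
    using Us Ks' \<open>\<zero> \<in> P\<close> unfolding independent_modulo_def by metis
  then show "set (take (length Us) Ks) \<subseteq> {\<zero>}"
    using Ks'(1) by blast
qed

text \<open>The entries are the products of the members of \<open>Us\<close> with the powers of
  \<open>x\<close> of exponent below the given number. The Horner-like recursion lets a combination
  split into a combination of \<open>Us\<close> plus \<open>x\<close> times a shorter one of the
  same kind.\<close>

primrec (in ring) horner_list :: "'a \<Rightarrow> 'a list \<Rightarrow> nat \<Rightarrow> 'a list" where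
  "horner_list x Us 0 = []"
| "horner_list x Us (Suc n) = Us @ map ((\<otimes>) x) (horner_list x Us n)"

lemma (in ring) length_horner_list: "length (horner_list x Us n) = n * length Us"
  by (induction n) auto

lemma (in ring) horner_list_closed:
  "x \<in> carrier R \<Longrightarrow> set Us \<subseteq> carrier R \<Longrightarrow> set (horner_list x Us n) \<subseteq> carrier R"
  by (induction n) auto

lemma (in cring) combine_map_mult:
  assumes "x \<in> carrier R" "set Ks \<subseteq> carrier R" "set Us \<subseteq> carrier R"
  shows "combine Ks (map ((\<otimes>) x) Us) = x \<otimes> combine Ks Us"
  using assms
proof (induction Ks Us rule: combine.induct)
  case (1 k Ks u Us)
  then have "x \<otimes> (k \<otimes> u \<oplus> combine Ks Us) = x \<otimes> (k \<otimes> u) \<oplus> x \<otimes> combine Ks Us"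
    by (intro r_distr) auto
  then show ?case
    using 1 by (simp add: m_lcomm)
qed auto

text \<open>The induction step lowers the prime: an element of \<open>Q - P\<close> acts like a new variable over \<open>Us\<close>,
  because reduction modulo \<open>Q\<close> isolates the constant coefficient of a polynomial in \<open>x\<close> and
  \<open>x\<close> can be cancelled modulo \<open>P\<close>.\<close>

lemma (in cring) independent_modulo_horner_list:
  assumes K: "subfield K R" and P: "primeideal P R" and Q: "ideal Q R" and "P \<subseteq> Q"
    and x: "x \<in> Q" "x \<notin> P" and Us: "independent_modulo K Q Us"
  shows "independent_modulo K P (horner_list x Us n)"
proof -
  interpret P: primeideal P R by fact
  interpret Q: ideal Q R by fact
  have xR: "x \<in> carrier R"
    using x(1) by (rule Q.a_Hcarr)
  have UR: "set Us \<subseteq> carrier R"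
    using Us unfolding independent_modulo_def by auto
  have KR: "K \<subseteq> carrier R"
    using subfieldE(3)[OF K] .
  have "set Ks \<subseteq> {\<zero>}"
    if "set Ks \<subseteq> K" "length Ks = length (horner_list x Us n)" "combine Ks (horner_list x Us n) \<in> P"
    for Ks
    using that
  proof (induction n arbitrary: Ks)
    case 0
    then show ?case by simp
  next
    case (Suc n)
    define A where "A = take (length Us) Ks"
    define B where "B = drop (length Us) Ks"
    have Ks: "Ks = A @ B" and AB: "length A = length Us" "length B = length (horner_list x Us n)"
      using Suc.prems(2) by (auto simp: A_def B_def)
    have sub: "set A \<subseteq> K" "set B \<subseteq> K"
      using Suc.prems(1) Ks by auto
    let ?H = "horner_list x Us n"
    have HR: "set ?H \<subseteq> carrier R"
      by (rule horner_list_closed[OF xR UR])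
    have cB: "combine B ?H \<in> carrier R" and cA: "combine A Us \<in> carrier R"
      using sub KR HR UR by (auto intro!: combine_in_carrier)
    have "combine Ks (horner_list x Us (Suc n)) = combine A Us \<oplus> combine B (map ((\<otimes>) x) ?H)"
      unfolding Ks horner_list.simps
      by (rule combine_append[symmetric]) (use AB sub KR UR HR xR in auto)
    also have "combine B (map ((\<otimes>) x) ?H) = x \<otimes> combine B ?H"
      by (rule combine_map_mult) (use sub KR HR xR in auto)
    finally have eq: "combine Ks (horner_list x Us (Suc n)) = combine A Us \<oplus> x \<otimes> combine B ?H" .
    have inQ: "x \<otimes> combine B ?H \<in> Q"
      using Q.I_r_closed[OF x(1) cB] .
    have "combine A Us \<oplus> x \<otimes> combine B ?H \<in> Q"
      using eq Suc.prems(3) \<open>P \<subseteq> Q\<close> by auto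
    then have "(combine A Us \<oplus> x \<otimes> combine B ?H) \<ominus> x \<otimes> combine B ?H \<in> Q"
      using inQ by (simp add: Q.a_closed Q.a_inv_closed minus_eq)
    moreover have "(combine A Us \<oplus> x \<otimes> combine B ?H) \<ominus> x \<otimes> combine B ?H = combine A Us"
      using cA cB xR by algebra
    ultimately have "combine A Us \<in> Q" by simp
    then have A0: "set A \<subseteq> {\<zero>}"
      using Us sub AB unfolding independent_modulo_def by blast
    then have "A = replicate (length Us) \<zero>"
      using AB(1) by (intro replicate_eqI) auto
    then have "combine A Us = \<zero>"
      using combine_replicate[OF UR] by simp
    then have "x \<otimes> combine B ?H \<in> P"
      using eq Suc.prems(3) cB xR by simp
    then have "combine B ?H \<in> P"
      using P.I_prime[OF xR cB] x(2) by blast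
    then have "set B \<subseteq> {\<zero>}"
      using Suc.IH sub(2) AB(2) by blast
    then show ?case
      using A0 Ks by auto
  qed
  then show ?thesis
    unfolding independent_modulo_def using horner_list_closed[OF xR UR] by blast
qed

lemma (in ring) horner_list_filtered:
  fixes V :: "nat \<Rightarrow> 'a set"
  assumes mult: "\<And>i j x y. x \<in> V i \<Longrightarrow> y \<in> V j \<Longrightarrow> x \<otimes> y \<in> V (i + j)"
    and "mono V" and "x \<in> V e" and "set Us \<subseteq> V i"
  shows "set (horner_list x Us n) \<subseteq> V (i + n * e)"
proof (induction n)
  case (Suc n)
  have "x \<otimes> u \<in> V (i + Suc n * e)" if "u \<in> set (horner_list x Us n)" for u
    using mult[of x e u "i + n * e"] that Suc \<open>x \<in> V e\<close> by (auto simp: algebra_simps)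
  moreover have "V i \<subseteq> V (i + Suc n * e)"
    using \<open>mono V\<close> by (simp add: monoD)
  ultimately show ?case
    using \<open>set Us \<subseteq> V i\<close> by auto
qed simp

text \<open>A nonzero scalar is a unit and thus lies in no proper ideal. This starts the descent
  along a chain of primes.\<close>

lemma (in ring) independent_modulo_one:
  assumes K: "subfield K R" and P: "ideal P R" "P \<noteq> carrier R"
  shows "independent_modulo K P [\<one>]"
proof -
  interpret P: ideal P R by fact
  have KR: "K \<subseteq> carrier R"
    using subfieldE(3)[OF K] .
  have "k = \<zero>" if "k \<in> K" "k \<in> P" for k
  proof (rule ccontr)
    assume "k \<noteq> \<zero>"
    then have "inv k \<in> K" "inv k \<otimes> k = \<one>"
      using subfield_m_inv[OF K, of k] that by auto
    then have "\<one> \<in> P"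
      using P.I_l_closed[of k "inv k"] that KR by auto
    then show False
      using P.one_imp_carrier P(2) by blast
  qed
  then show ?thesis
    using KR by (auto simp: independent_modulo_def length_Suc_conv subset_iff)
qed

text \<open>With \<open>d + 1\<close> strict inclusions, one element from each gap yields
  \<open>N ^ (d + 1)\<close> independent elements in a filtration step that grows linearly with
  \<open>N\<close>. That step has dimension of order at most \<open>N ^ d\<close>, which is a
  contradiction for large \<open>N\<close>.\<close>

lemma (in cring) prime_chain_length_le:
  fixes V :: "nat \<Rightarrow> 'a set" and P :: "nat \<Rightarrow> 'a set"
  assumes K: "subfield K R"
    and mult: "\<And>i j x y. x \<in> V i \<Longrightarrow> y \<in> V j \<Longrightarrow> x \<otimes> y \<in> V (i + j)"
    and mono: "mono V" and one: "\<one> \<in> V 0" and exhaust: "carrier R \<subseteq> (\<Union>i. V i)"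
    and dim: "\<And>i. \<exists>m \<le> (i + 1) ^ d. dimension m K (V i)"
    and prime: "\<And>i. i \<le> k \<Longrightarrow> primeideal (P i) R" and chain: "\<And>i. i < k \<Longrightarrow> P i \<subset> P (Suc i)"
  shows "k \<le> d"
proof (rule ccontr)
  assume "\<not> k \<le> d"
  then have k: "Suc d \<le> k" by simp
  have "\<exists>x. x \<in> P (Suc i) \<and> x \<notin> P i" if "i < k" for i
    using chain[OF that] by blast
  then obtain x where x: "\<And>i. i < k \<Longrightarrow> x i \<in> P (Suc i)" "\<And>i. i < k \<Longrightarrow> x i \<notin> P i"
    by metis
  have idl: "ideal (P i) R" if "i \<le> k" for i
    using prime[OF that] unfolding primeideal_def by blast
  have xR: "x i \<in> carrier R" if "i < k" for i
    using ideal.Icarr[OF idl x(1)[OF that]] that by simp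
  have "\<exists>j. x i \<in> V j" if "i < k" for i
    using xR[OF that] exhaust by blast
  then obtain f where f: "\<And>i. i < k \<Longrightarrow> x i \<in> V (f i)"
    by metis
  \<comment> \<open>A single filtration index that contains all the chosen elements
    \<open>x i\<close>.\<close>
  define e where "e = Max (f ` {..<k})"
  have xV: "x i \<in> V e" if "i < k" for i
    using f[OF that] that monoD[OF mono, of "f i" e] by (auto simp: e_def)
  \<comment> \<open>Chosen to exceed the constant by which the dimension bound at index
    \<open>Suc d * N * e\<close> differs from \<open>N ^ d\<close>.\<close>
  define N where "N = Suc ((Suc d * e + 1) ^ d)"
  \<comment> \<open>The induction descends from \<open>P (Suc d)\<close> to \<open>P 0\<close>. Each
    prime passed multiplies the number of independent elements by \<open>N\<close> and raises the
    filtration index by \<open>N * e\<close>.\<close>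
  have step: "\<exists>Us. independent_modulo K (P (Suc d - j)) Us \<and> length Us = N ^ j \<and> set Us \<subseteq> V (j * N * e)"
    if "j \<le> Suc d" for j
    using that
  proof (induction j)
    case 0
    have "independent_modulo K (P (Suc d)) [\<one>]"
      by (intro independent_modulo_one K idl primeideal.I_notcarr[OF prime, symmetric] k)
    then show ?case
      using one by (intro exI[of _ "[\<one>]"]) auto
  next
    case (Suc j)
    then obtain Us where Us: "independent_modulo K (P (Suc d - j)) Us" "length Us = N ^ j"
        "set Us \<subseteq> V (j * N * e)" by auto
    define i where "i = d - j"
    have i: "Suc d - j = Suc i" "Suc d - Suc j = i" "i < k"
      using Suc.prems k by (auto simp: i_def)
    have "independent_modulo K (P i) (horner_list (x i) Us N)"
      using chain[of i] i Us(1) k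
      by (intro independent_modulo_horner_list[OF K prime idl, of _ "Suc i"] x) auto
    moreover have "set (horner_list (x i) Us N) \<subseteq> V (j * N * e + N * e)"
      by (rule horner_list_filtered[OF mult mono xV[OF i(3)] Us(3)])
    ultimately show ?case
      using Us(2) i by (intro exI[of _ "horner_list (x i) Us N"])
        (auto simp: length_horner_list algebra_simps)
  qed
  obtain Us where Us: "independent_modulo K (P 0) Us" "length Us = N ^ Suc d"
      "set Us \<subseteq> V (Suc d * N * e)"
    using step[of "Suc d"] by auto
  have "\<zero> \<in> P 0"
    using additive_subgroup.zero_closed[OF ideal.axioms(1)[OF idl]] by simp
  then have ind: "independent K Us"
    using independent_modulo_imp_independent[OF K Us(1)] by simp
  obtain m where m: "m \<le> (Suc d * N * e + 1) ^ d" "dimension m K (V (Suc d * N * e))"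
    using dim by blast
  have "N ^ Suc d \<le> m"
    using independent_length_le_dimension[OF K m(2) ind Us(3)] Us(2) by simp
  also have "m \<le> (N * (Suc d * e + 1)) ^ d"
    using m(1) by (rule order_trans) (intro power_mono, auto simp: N_def algebra_simps)
  also have "\<dots> = N ^ d * (Suc d * e + 1) ^ d"
    by (rule power_mult_distrib)
  also have "\<dots> < N ^ d * N"
    by (simp add: N_def)
  finally show False by simp
qed

section \<open>Algebras spanned by monomials\<close>

text \<open>A linear order on the variables makes the polynomial ring an instance of \<^class>\<open>idom\<close>.\<close>

instantiation vertex :: linorder
begin

definition vertex_rank :: "vertex \<Rightarrow> nat" where
  "vertex_rank v = (case v of VX i \<Rightarrow> 2 * i | VY i \<Rightarrow> 2 * i + 1)"

definition less_eq_vertex :: "vertex \<Rightarrow> vertex \<Rightarrow> bool" where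
  "v \<le> w \<longleftrightarrow> vertex_rank v \<le> vertex_rank w"

definition less_vertex :: "vertex \<Rightarrow> vertex \<Rightarrow> bool" where
  "v < w \<longleftrightarrow> vertex_rank v < vertex_rank w"

lemma vertex_rank_inject: "vertex_rank v = vertex_rank w \<longleftrightarrow> v = w"
proof -
  have "2 * i \<noteq> Suc (2 * j)" "Suc (2 * j) \<noteq> 2 * i" for i j :: nat
    by presburger+
  then show ?thesis
    by (cases v; cases w) (auto simp: vertex_rank_def)
qed

instance
  by standard (auto simp: less_eq_vertex_def less_vertex_def simp flip: vertex_rank_inject)

end

text \<open>\<open>(c, k)\<close> stands for the monomial with exponents \<open>c\<close> in the vertices and \<open>k\<close> in \<open>t\<close>.\<close>

type_synonym mon = "(vertex \<Rightarrow>\<^sub>0 nat) \<times> nat"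

definition monomial :: "mon \<Rightarrow> 'k::field mpoly poly" where
  "monomial s = cover_monomial (fst s) (snd s)"

definition mcoeff :: "'k::field mpoly poly \<Rightarrow> mon \<Rightarrow> 'k" where
  "mcoeff f s = Poly_Mapping.lookup (Polynomial.coeff f (snd s)) (fst s)"

definition scalar :: "'k::field \<Rightarrow> 'k mpoly poly" where
  "scalar a = [:Poly_Mapping.single 0 a:]"

lemma scalars_eq: "scalars = range scalar"
  by (auto simp: scalars_def scalar_def)

lemma scalar_simps [simp]:
  "scalar 0 = 0" "scalar 1 = 1" "scalar (a + b) = scalar a + scalar b"
  "scalar (- a) = - scalar a" "scalar (a * b) = scalar a * scalar b"
  by (simp_all add: scalar_def single_add mult_single single_uminus one_pCons mult.commute[of a] flip: single_one)

lemma mcoeff_eqI: "(\<And>s. mcoeff f s = mcoeff g s) \<Longrightarrow> f = g"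
  by (rule poly_eqI, rule poly_mapping_eqI) (force simp: mcoeff_def)

lemma mcoeff_simps [simp]:
  "mcoeff 0 s = 0" "mcoeff (f + g) s = mcoeff f s + mcoeff g s"
  "mcoeff (- f) s = - mcoeff f s" "mcoeff (f - g) s = mcoeff f s - mcoeff g s"
  by (simp_all add: mcoeff_def lookup_add lookup_minus lookup_uminus)

lemma mcoeff_sum: "mcoeff (\<Sum>x\<in>A. f x) s = (\<Sum>x\<in>A. mcoeff (f x) s)"
  by (induction A rule: infinite_finite_induct) auto

lemma mcoeff_monomial: "mcoeff (monomial s) t = (if s = t then 1 else 0)"
  by (auto simp: mcoeff_def monomial_def cover_monomial_def lookup_single prod_eq_iff when_def)

lemma mcoeff_scalar_mult [simp]: "mcoeff (scalar a * f) s = a * mcoeff f s"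
  by (simp add: mcoeff_def scalar_def Poly_Mapping.map.rep_eq when_def flip: mult_map_scale_conv_mult)

lemma monomial_add: "monomial (s + t) = monomial s * monomial t"
  by (simp add: monomial_def cover_monomial_def mult_monom mult_single)

lemma monomial_0: "monomial 0 = 1"
  by (simp add: monomial_def cover_monomial_def)

lemma finite_mcoeff: "finite {s. mcoeff f s \<noteq> 0}"
proof (rule finite_subset)
  show "{s. mcoeff f s \<noteq> 0} \<subseteq>
      (\<Union>k\<le>Polynomial.degree f. Poly_Mapping.keys (Polynomial.coeff f k) \<times> {k})"
    by (auto simp: mcoeff_def in_keys_iff) (metis coeff_eq_0 lookup_zero not_le)
qed simp

lemma mcoeff_expand:
  assumes "finite A" "{s. mcoeff f s \<noteq> 0} \<subseteq> A"
  shows "f = (\<Sum>s\<in>A. scalar (mcoeff f s) * monomial s)"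
proof (rule mcoeff_eqI)
  fix t
  have "(\<Sum>s\<in>A. mcoeff f s * (if s = t then 1 else 0)) = (if t \<in> A then mcoeff f t else 0)"
    using \<open>finite A\<close> by (simp add: if_distrib sum.delta' cong: if_cong)
  also have "\<dots> = mcoeff f t"
    using assms(2) by auto
  finally show "mcoeff f t = mcoeff (\<Sum>s\<in>A. scalar (mcoeff f s) * monomial s) t"
    by (simp add: mcoeff_sum mcoeff_monomial)
qed

text \<open>This is the \<open>K\<close>-span of the monomials with exponents in \<open>T\<close>.
  Describing it by coefficients makes intersections and complements of supports directly
  accessible.\<close>

definition supported :: "mon set \<Rightarrow> 'k::field mpoly poly set" where
  "supported T = {f. \<forall>s. mcoeff f s \<noteq> 0 \<longrightarrow> s \<in> T}"

lemma supportedI: "(\<And>s. mcoeff f s \<noteq> 0 \<Longrightarrow> s \<in> T) \<Longrightarrow> f \<in> supported T"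
  unfolding supported_def by blast

lemma supportedD: "f \<in> supported T \<Longrightarrow> mcoeff f s \<noteq> 0 \<Longrightarrow> s \<in> T"
  unfolding supported_def by blast

lemma supported_closed:
  "0 \<in> supported T"
  "f \<in> supported T \<Longrightarrow> g \<in> supported T \<Longrightarrow> f + g \<in> supported T"
  "f \<in> supported T \<Longrightarrow> - f \<in> supported T"
  "f \<in> supported T \<Longrightarrow> scalar a * f \<in> supported T"
  by (auto intro!: supportedI dest: supportedD) (metis add_0 supportedD)

lemma supported_sum: "(\<And>x. x \<in> A \<Longrightarrow> f x \<in> supported T) \<Longrightarrow> (\<Sum>x\<in>A. f x) \<in> supported T"
  by (induction A rule: infinite_finite_induct) (auto intro: supported_closed)

lemma supported_mono: "S \<subseteq> T \<Longrightarrow> supported S \<subseteq> supported T"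
  by (auto simp: supported_def)

lemma monomial_supported: "(monomial s :: 'k::field mpoly poly) \<in> supported T \<longleftrightarrow> s \<in> T"
  using supportedD[of "monomial s :: 'k mpoly poly" T s]
  by (auto simp: mcoeff_monomial intro: supportedI split: if_splits)

lemma scalar_supported: "0 \<in> T \<Longrightarrow> scalar a \<in> supported T"
  using supported_closed(4)[of "monomial 0" T a] by (simp add: monomial_supported) (simp add: monomial_0)

lemma supported_mult:
  fixes f g :: "'k::field mpoly poly"
  assumes "f \<in> supported S" "g \<in> supported T" and ST: "\<And>s t. s \<in> S \<Longrightarrow> t \<in> T \<Longrightarrow> s + t \<in> U"
  shows "f * g \<in> supported U"
proof -
  let ?A = "{s. mcoeff f s \<noteq> 0}" and ?B = "{s. mcoeff g s \<noteq> 0}"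
  have "f * g = (\<Sum>s\<in>?A. scalar (mcoeff f s) * monomial s) * (\<Sum>t\<in>?B. scalar (mcoeff g t) * monomial t)"
    by (rule arg_cong2[of _ _ _ _ "(*)"]; rule mcoeff_expand[OF finite_mcoeff order_refl])
  also have "\<dots> = (\<Sum>s\<in>?A. \<Sum>t\<in>?B. scalar (mcoeff f s * mcoeff g t) * monomial (s + t))"
    unfolding sum_product by (intro sum.cong refl) (simp add: monomial_add mult.assoc mult.left_commute)
  also have "\<dots> \<in> supported U"
    using supportedD[OF assms(1)] supportedD[OF assms(2)]
    by (intro supported_sum supported_closed) (simp add: monomial_supported ST)
  finally show ?thesis .
qed

lemma supported_Int: "f \<in> supported S \<Longrightarrow> f \<in> supported T \<Longrightarrow> f \<in> supported (S \<inter> T)"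
  by (auto simp: supported_def)

lemma supported_empty: "supported {} = {0}"
  by (auto simp: supported_def intro: mcoeff_eqI)

lemma supported_split:
  fixes f :: "'k::field mpoly poly"
  assumes "f \<in> supported S"
  obtains g h where "f = g + h" "g \<in> supported (S \<inter> Z)" "h \<in> supported (S - Z)"
proof -
  let ?A = "{s. mcoeff f s \<noteq> 0}"
  have "f = (\<Sum>s\<in>?A. scalar (mcoeff f s) * monomial s)"
    by (rule mcoeff_expand[OF finite_mcoeff order_refl])
  also have "\<dots> = (\<Sum>s\<in>?A \<inter> Z. scalar (mcoeff f s) * monomial s) +
      (\<Sum>s\<in>?A - Z. scalar (mcoeff f s) * monomial s)"
    by (rule sum.Int_Diff[OF finite_mcoeff])
  finally show ?thesis
    by (rule that; intro supported_sum supported_closed)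
       (use supportedD[OF assms] in \<open>simp_all add: monomial_supported\<close>)
qed

definition monoid_algebra :: "mon set \<Rightarrow> 'k::field mpoly poly ring" where
  "monoid_algebra S = ambient\<lparr>carrier := supported S\<rparr>"

lemma ambient_simps:
  "carrier ambient = UNIV" "f \<otimes>\<^bsub>ambient\<^esub> g = f * g" "f \<oplus>\<^bsub>ambient\<^esub> g = f + g"
  "\<one>\<^bsub>ambient\<^esub> = 1" "\<zero>\<^bsub>ambient\<^esub> = 0"
  by (simp_all add: ambient_def ring_of_type_algebra_def)

lemma cring_ambient: "cring (ambient :: 'k::field mpoly poly ring)"
  unfolding ambient_def by (rule cring_from_type_algebra)

lemma ambient_uminus: "\<ominus>\<^bsub>ambient\<^esub> f = - f"
proof -
  interpret cring "ambient :: 'a mpoly poly ring" by (rule cring_ambient)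
  show ?thesis
    by (rule minus_equality) (simp_all add: ambient_simps)
qed

lemma monoid_algebra_simps [simp]:
  "carrier (monoid_algebra S) = supported S" "f \<otimes>\<^bsub>monoid_algebra S\<^esub> g = f * g"
  "f \<oplus>\<^bsub>monoid_algebra S\<^esub> g = f + g" "\<one>\<^bsub>monoid_algebra S\<^esub> = 1" "\<zero>\<^bsub>monoid_algebra S\<^esub> = 0"
  by (simp_all add: monoid_algebra_def ambient_simps)

section \<open>Submonoids, their monoid algebras and the primes given by faces\<close>

locale submonoid =
  fixes S :: "mon set"
  assumes zero_mem: "0 \<in> S" and add_mem: "s \<in> S \<Longrightarrow> t \<in> S \<Longrightarrow> s + t \<in> S"
begin

lemma subcring_supported: "subcring (supported S) (ambient :: 'k::field mpoly poly ring)"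
proof -
  interpret cring "ambient :: 'k mpoly poly ring" by (rule cring_ambient)
  show ?thesis
  proof (rule subcringI'[OF subringI])
    show "\<one>\<^bsub>ambient\<^esub> \<in> supported S"
      using scalar_supported[OF zero_mem, of 1] by (simp add: ambient_simps)
  qed (auto simp: ambient_simps ambient_uminus intro: supported_closed supported_mult add_mem)
qed

lemma cring_monoid_algebra: "cring (monoid_algebra S :: 'k::field mpoly poly ring)"
  unfolding monoid_algebra_def
  using ring.subcring_iff[OF cring.axioms(1)[OF cring_ambient]] subcring_supported by (auto simp: ambient_simps)

lemma subfield_scalars: "subfield scalars (monoid_algebra S :: 'k::field mpoly poly ring)"
proof -
  interpret cring "monoid_algebra S :: 'k mpoly poly ring" by (rule cring_monoid_algebra)
  have uminus: "\<ominus>\<^bsub>monoid_algebra S\<^esub> f = - f" if "f \<in> supported S" for f :: "'k mpoly poly"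
    by (rule minus_equality) (use that in \<open>auto intro: supported_closed\<close>)
  have "subcring scalars (monoid_algebra S :: 'k mpoly poly ring)"
  proof (rule subcringI'[OF subringI])
    show "\<one>\<^bsub>monoid_algebra S\<^esub> \<in> (scalars :: 'k mpoly poly set)"
      unfolding scalars_eq monoid_algebra_simps by (rule range_eqI[of _ _ 1]) simp
    fix f g :: "'k mpoly poly"
    assume f: "f \<in> scalars" 
    then obtain a where a: "f = scalar a" by (auto simp: scalars_eq)
    show "\<ominus>\<^bsub>monoid_algebra S\<^esub> f \<in> scalars"
      unfolding a by (subst uminus) (auto simp: scalars_eq scalar_supported zero_mem intro!: range_eqI[of _ _ "- a"])
    assume g: "g \<in> scalars" 
    then obtain b where b: "g = scalar b" by (auto simp: scalars_eq)
    show "f \<otimes>\<^bsub>monoid_algebra S\<^esub> g \<in> scalars"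
      unfolding a b by (auto simp: scalars_eq intro!: range_eqI[of _ _ "a * b"])
    show "f \<oplus>\<^bsub>monoid_algebra S\<^esub> g \<in> scalars"
      unfolding a b by (auto simp: scalars_eq intro!: range_eqI[of _ _ "a + b"])
  qed (auto simp: scalars_eq scalar_supported zero_mem)
  moreover have "Units (monoid_algebra S\<lparr>carrier := scalars :: 'k mpoly poly set\<rparr>) = scalars - {0}"
  proof -
    have "scalar a \<noteq> 0" if "a \<noteq> 0" for a :: 'k
      using that by (simp add: scalar_def) (metis lookup_single_eq lookup_zero)
    then have "\<exists>g\<in>scalars. g * f = 1 \<and> f * g = 1" if f: "f \<in> scalars" "f \<noteq> 0" for f :: "'k mpoly poly"
    proof -
      obtain a where "f = scalar a"
        using f(1) unfolding scalars_eq by blast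
      with f(2) have a: "f = scalar a" "a \<noteq> 0"
        by auto
      then have "scalar (inverse a) * f = 1" "f * scalar (inverse a) = 1"
        by (simp_all flip: scalar_simps(5))
      then show ?thesis
        unfolding scalars_eq by blast
    qed
    then show ?thesis
      by (auto simp: Units_def)
  qed
  ultimately show ?thesis
    by (intro subfieldI) auto
qed

text \<open>Enlarging the support by one exponent is a line extension by its monomial: subtracting
  the term at that exponent leads back to the smaller support. Both claims follow by
  induction.\<close>

lemma dimension_supported:
  assumes "finite T" "T \<subseteq> S"
  shows "ring.dimension (monoid_algebra S) (card T) (scalars :: 'k::field mpoly poly set) (supported T)"
    and "set ts = T \<Longrightarrow> ring.Span (monoid_algebra S) (scalars :: 'k mpoly poly set) (map monomial ts) = supported T"
proof -
  interpret cring "monoid_algebra S :: 'k mpoly poly ring" by (rule cring_monoid_algebra)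
  have ext: "line_extension scalars (monomial s) (supported A) = (supported (insert s A) :: 'k mpoly poly set)"
    for s and A
  proof (intro equalityI subsetI)
    fix f :: "'k mpoly poly"
    assume "f \<in> line_extension scalars (monomial s) (supported A)"
    then show "f \<in> supported (insert s A)"
      using supported_mono[of A "insert s A"]
      by (auto simp: line_extension_mem_iff scalars_eq monomial_supported intro!: supported_closed)
  next
    fix f :: "'k mpoly poly"
    assume f: "f \<in> supported (insert s A)"
    define g where "g = f - scalar (mcoeff f s) * monomial s"
    have "g \<in> supported A"
      using f by (auto simp: supported_def g_def mcoeff_monomial)
    then show "f \<in> line_extension scalars (monomial s) (supported A)"
      unfolding line_extension_mem_iff
      by (intro bexI[of _ "scalar (mcoeff f s)"] bexI[of _ g]) (auto simp: g_def scalars_eq)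
  qed
  show "dimension (card T) (scalars :: 'k mpoly poly set) (supported T)"
    using assms
  proof (induction T rule: finite_induct)
    case empty
    then show ?case
      using zero_dim by (simp add: supported_empty)
  next
    case (insert s T)
    then show ?case
      using Suc_dim[of "monomial s" "supported T" "card T" scalars]
      by (simp add: ext monomial_supported)
  qed
  show "Span (scalars :: 'k mpoly poly set) (map monomial ts) = supported T" if "set ts = T"
    using that[symmetric] by (induction ts arbitrary: T) (auto simp: supported_empty ext)
qed

text \<open>Equivalently, \<open>S - Z\<close> is a prime ideal (possibly empty) of the monoid
  \<open>S\<close>.\<close>

definition face :: "mon set \<Rightarrow> bool" where
  "face Z \<longleftrightarrow> 0 \<in> Z \<and> Z \<subseteq> S \<and> (\<forall>s\<in>S. \<forall>t\<in>S. s + t \<in> Z \<longleftrightarrow> s \<in> Z \<and> t \<in> Z)"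

text \<open>Split both factors into their parts on and off \<open>Z\<close>. If the product is
  supported off \<open>Z\<close>, so is the product of the two parts on \<open>Z\<close>; but that
  product is also supported on \<open>Z\<close>, hence zero, and the polynomial ring is a
  domain.\<close>

lemma face_primeideal:
  assumes "face Z"
  shows "primeideal (supported (S - Z)) (monoid_algebra S :: 'k::field mpoly poly ring)"
proof -
  interpret cring "monoid_algebra S :: 'k mpoly poly ring" by (rule cring_monoid_algebra)
  have uminus: "\<ominus>\<^bsub>monoid_algebra S\<^esub> f = - f" if "f \<in> supported S" for f :: "'k mpoly poly"
    by (rule minus_equality) (use that in \<open>auto intro: supported_closed\<close>)
  have Z: "0 \<in> Z" "Z \<subseteq> S" and face: "\<And>s t. s \<in> S \<Longrightarrow> t \<in> S \<Longrightarrow> s + t \<in> Z \<longleftrightarrow> s \<in> Z \<and> t \<in> Z"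
    using assms by (auto simp: face_def)
  have sub: "supported (S - Z) \<subseteq> (supported S :: 'k mpoly poly set)"
    by (rule supported_mono) auto
  show ?thesis
  proof (rule primeidealI)
    show "ideal (supported (S - Z)) (monoid_algebra S :: 'k mpoly poly ring)"
    proof (rule idealI[OF ring_axioms])
      show "subgroup (supported (S - Z)) (add_monoid (monoid_algebra S :: 'k mpoly poly ring))"
      proof (rule add.subgroupI)
        fix f :: "'k mpoly poly"
        assume "f \<in> supported (S - Z)"
        then show "\<ominus>\<^bsub>monoid_algebra S\<^esub> f \<in> supported (S - Z)"
          using sub by (subst uminus) (auto intro: supported_closed)
      qed (use sub in \<open>auto intro: supported_closed\<close>)
      show "g \<otimes>\<^bsub>monoid_algebra S\<^esub> f \<in> supported (S - Z)" "f \<otimes>\<^bsub>monoid_algebra S\<^esub> g \<in> supported (S - Z)"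
        if "f \<in> supported (S - Z)" "g \<in> carrier (monoid_algebra S)" for f g :: "'k mpoly poly"
        using supported_mult[of g S f "S - Z" "S - Z"] supported_mult[of f "S - Z" g S "S - Z"] that
        by (simp_all add: add_mem face)
    qed
    show "cring (monoid_algebra S :: 'k mpoly poly ring)" by (rule cring_monoid_algebra)
    have "(monomial 0 :: 'k mpoly poly) \<in> supported S" "(monomial 0 :: 'k mpoly poly) \<notin> supported (S - Z)"
      using Z by (auto simp: monomial_supported zero_mem)
    then show "carrier (monoid_algebra S) \<noteq> (supported (S - Z) :: 'k mpoly poly set)"
      by auto
  next
    fix f g :: "'k mpoly poly"
    assume "f \<in> carrier (monoid_algebra S)" "g \<in> carrier (monoid_algebra S)"
      and fg: "f \<otimes>\<^bsub>monoid_algebra S\<^esub> g \<in> supported (S - Z)"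
    then have fS: "f \<in> supported S" and gS: "g \<in> supported S" by auto
    obtain f1 f2 where f: "f = f1 + f2" "f1 \<in> supported (S \<inter> Z)" "f2 \<in> supported (S - Z)"
      by (rule supported_split[OF fS])
    obtain g1 g2 where g: "g = g1 + g2" "g1 \<in> supported (S \<inter> Z)" "g2 \<in> supported (S - Z)"
      by (rule supported_split[OF gS])
    have "f1 * g2 \<in> supported (S - Z)" "f2 * g \<in> supported (S - Z)"
      by (rule supported_mult[OF f(2) g(3)] supported_mult[OF f(3) gS]; simp add: face add_mem)+
    then have "f * g + - (f1 * g2) + - (f2 * g) \<in> supported (S - Z)"
      using fg by (intro supported_closed) auto
    then have "f1 * g1 \<in> supported (S - Z)"
      by (simp add: f(1) g(1) algebra_simps)
    moreover have "(S - Z) \<inter> (S \<inter> Z) = {}"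
      by blast
    moreover have "f1 * g1 \<in> supported (S \<inter> Z)"
      by (rule supported_mult[OF f(2) g(2)]) (simp add: face add_mem)
    ultimately have "f1 * g1 \<in> supported {}"
      using supported_Int[of "f1 * g1" "S - Z" "S \<inter> Z"] by simp
    then have "f1 = 0 \<or> g1 = 0"
      by (simp add: supported_empty)
    then show "f \<in> supported (S - Z) \<or> g \<in> supported (S - Z)"
      using f g by auto
  qed
qed

end

lemma supported_UN_mono:
  fixes f :: "'k::field mpoly poly" and T :: "nat \<Rightarrow> mon set"
  assumes "mono T" "f \<in> supported (\<Union>i. T i)"
  obtains i where "f \<in> supported (T i)"
proof -
  have "\<exists>i. s \<in> T i" if "mcoeff f s \<noteq> 0" for s
    using supportedD[OF assms(2) that] by blast
  then obtain g where g: "\<And>s. mcoeff f s \<noteq> 0 \<Longrightarrow> s \<in> T (g s)"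
    by metis
  define i where "i = Max (g ` {s. mcoeff f s \<noteq> 0})"
  have "s \<in> T i" if "mcoeff f s \<noteq> 0" for s
  proof -
    have "g s \<le> i"
      using finite_mcoeff[of f] that by (auto simp: i_def)
    then show ?thesis
      using g[OF that] monoD[OF \<open>mono T\<close>] by blast
  qed
  then show ?thesis
    by (intro that supportedI)
qed

section \<open>Primes of quotients and computation of the Krull dimension\<close>

lemma (in cring) rcoset_mem_image_iff:
  assumes I: "ideal I R" and P: "ideal P R" and "I \<subseteq> P" and x: "x \<in> carrier R"
  shows "I +> x \<in> (+>) I ` P \<longleftrightarrow> x \<in> P"
proof
  interpret I: ideal I R by fact
  interpret P: ideal P R by fact
  assume "I +> x \<in> (+>) I ` P"
  then obtain y where y: "y \<in> P" "I +> x = I +> y"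
    by auto
  have "x \<in> I +> y"
    using I.a_rcos_self[OF x] y(2) by simp
  then obtain i where "i \<in> I" "x = i \<oplus> y"
    unfolding a_r_coset_def' by auto
  then show "x \<in> P"
    using \<open>I \<subseteq> P\<close> y(1) P.a_closed by auto
qed auto

lemma (in cring) quotient_primeideal:
  assumes I: "ideal I R" and P: "primeideal P R" and "I \<subseteq> P"
  shows "primeideal ((+>) I ` P) (R Quot I)"
proof -
  interpret P: primeideal P R by fact
  interpret hom: ring_hom_ring R "R Quot I" "(+>) I"
    by (rule ideal.rcos_ring_hom_ring[OF I])
  have carrier: "carrier (R Quot I) = (+>) I ` carrier R"
    unfolding FactRing_def A_RCOSETS_def' by auto
  note mem = rcoset_mem_image_iff[OF I P.is_ideal \<open>I \<subseteq> P\<close>]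
  show ?thesis
  proof (rule primeidealI)
    show "ideal ((+>) I ` P) (R Quot I)"
      by (rule ring_ideal_imp_quot_ideal[OF I P.is_ideal])
    show "cring (R Quot I)"
      by (rule ideal.quotient_is_cring[OF I is_cring])
    obtain x where "x \<in> carrier R" "x \<notin> P"
      using P.I_notcarr P.Icarr by blast
    then have "I +> x \<in> carrier (R Quot I)" "I +> x \<notin> (+>) I ` P"
      using mem carrier by simp_all
    then show "carrier (R Quot I) \<noteq> (+>) I ` P"
      by metis
    fix a b assume ab: "a \<in> carrier (R Quot I)" "b \<in> carrier (R Quot I)" "a \<otimes>\<^bsub>R Quot I\<^esub> b \<in> (+>) I ` P"
    then obtain x y where xy: "x \<in> carrier R" "a = I +> x" "y \<in> carrier R" "b = I +> y"
      unfolding carrier by auto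
    then have "I +> (x \<otimes> y) \<in> (+>) I ` P"
      using ab(3) by (simp add: hom.hom_mult)
    then have "x \<otimes> y \<in> P"
      using mem[of "x \<otimes> y"] xy by (metis m_closed)
    then show "a \<in> (+>) I ` P \<or> b \<in> (+>) I ` P"
      using P.I_prime xy by blast
  qed
qed

text \<open>The growth of the filtration \<open>V\<close> bounds every chain of primes, and the
  chain \<open>P\<close> attains the bound.\<close>

lemma (in cring) krull_dim_eq:
  fixes V :: "nat \<Rightarrow> 'a set" and P :: "nat \<Rightarrow> 'a set"
  assumes "subfield K R"
    and "\<And>i j x y. x \<in> V i \<Longrightarrow> y \<in> V j \<Longrightarrow> x \<otimes> y \<in> V (i + j)"
    and "mono V" and "\<one> \<in> V 0" and "carrier R \<subseteq> (\<Union>i. V i)"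
    and "\<And>i. \<exists>m \<le> (i + 1) ^ d. dimension m K (V i)"
    and "\<And>i. i \<le> d \<Longrightarrow> primeideal (P i) R" and "\<And>i. i < d \<Longrightarrow> P i \<subset> P (Suc i)"
  shows "krull_dim R = enat d"
  unfolding krull_dim_def
proof (rule antisym[OF Sup_least Sup_upper])
  fix e assume "e \<in> {enat k |k. \<exists>P. (\<forall>i\<le>k. primeideal (P i) R) \<and> (\<forall>i<k. P i \<subset> P (Suc i))}"
  then obtain k Q where k: "e = enat k" "\<And>i. i \<le> k \<Longrightarrow> primeideal (Q i) R" "\<And>i. i < k \<Longrightarrow> Q i \<subset> Q (Suc i)"
    by auto
  then show "e \<le> enat d"
    using prime_chain_length_le[where V = V and P = Q and k = k and d = d, OF assms(1-6) k(2,3)] by simp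
qed (use assms(7,8) in blast)

context submonoid
begin

lemma krull_dim_monoid_algebra:
  assumes fil: "\<And>i. finite (T i)" "\<And>i. card (T i) \<le> (i + 1) ^ d" "mono T" "(\<Union>i. T i) = S" "0 \<in> T 0"
    "\<And>i j s t. s \<in> T i \<Longrightarrow> t \<in> T j \<Longrightarrow> s + t \<in> T (i + j)"
    and Z: "\<And>i. i \<le> d \<Longrightarrow> face (Z i)" "\<And>i. i < d \<Longrightarrow> Z (Suc i) \<subset> Z i"
  shows "krull_dim (monoid_algebra S :: 'k::field mpoly poly ring) = enat d"
proof -
  interpret cring "monoid_algebra S :: 'k mpoly poly ring" by (rule cring_monoid_algebra)
  show ?thesis
  proof (rule krull_dim_eq[OF subfield_scalars, where V = "\<lambda>i. supported (T i)" and
        P = "\<lambda>i. supported (S - Z i)"])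
    show "f \<otimes>\<^bsub>monoid_algebra S\<^esub> g \<in> supported (T (i + j))"
      if "f \<in> supported (T i)" "g \<in> supported (T j)" for i j and f g :: "'k mpoly poly"
      using that by (auto intro: supported_mult fil(6))
    show "mono (\<lambda>i. supported (T i) :: 'k mpoly poly set)"
      using fil(3) by (auto intro!: monoI supported_mono dest: monoD)
    show "\<one>\<^bsub>monoid_algebra S\<^esub> \<in> (supported (T 0) :: 'k mpoly poly set)"
      using scalar_supported[OF fil(5), of 1] by simp
    show "carrier (monoid_algebra S) \<subseteq> (\<Union>i. supported (T i) :: 'k mpoly poly set)"
    proof
      fix f :: "'k mpoly poly" assume "f \<in> carrier (monoid_algebra S)"
      then have "f \<in> supported (\<Union>i. T i)"
        using fil(4) by simp
      then show "f \<in> (\<Union>i. supported (T i))"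
        by (rule supported_UN_mono[OF fil(3)]) blast
    qed
    show "\<exists>m\<le>(i + 1) ^ d. dimension m (scalars :: 'k mpoly poly set) (supported (T i))" for i
      using dimension_supported(1)[of "T i"] fil(1,2,4) by blast
    show "primeideal (supported (S - Z i)) (monoid_algebra S :: 'k mpoly poly ring)" if "i \<le> d" for i
      using face_primeideal Z(1)[OF that] .
    show "supported (S - Z i) \<subset> (supported (S - Z (Suc i)) :: 'k mpoly poly set)" if "i < d" for i
    proof -
      have "\<exists>s. s \<in> Z i \<and> s \<notin> Z (Suc i)"
        using Z(2)[OF that] by blast
      then obtain s where s: "s \<in> Z i" "s \<notin> Z (Suc i)"
        by blast
      moreover have "s \<in> S"
        using Z(1)[of i] s that by (auto simp: face_def)
      ultimately have "(monomial s :: 'k mpoly poly) \<in> supported (S - Z (Suc i)) - supported (S - Z i)"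
        by (simp add: monomial_supported)
      moreover have "supported (S - Z i) \<subseteq> (supported (S - Z (Suc i)) :: 'k mpoly poly set)"
        using Z(2)[OF that] by (intro supported_mono) auto
      ultimately show ?thesis by blast
    qed
  qed
qed

end

section \<open>The quotient by the monomials outside a face\<close>

locale face_quotient = submonoid +
  fixes W :: "mon set"
  assumes face_W: "face W"
begin

definition quotient_map :: "'k::field mpoly poly \<Rightarrow> 'k mpoly poly set" where
  "quotient_map f = supported (S - W) +>\<^bsub>monoid_algebra S\<^esub> f"

abbreviation quotient :: "'k::field mpoly poly set ring" where
  "quotient \<equiv> monoid_algebra S Quot supported (S - W)"

lemma quotient_hom: "ring_hom_ring (monoid_algebra S :: 'k::field mpoly poly ring) quotient quotient_map"
proof -
  interpret P: primeideal "supported (S - W)" "monoid_algebra S :: 'k mpoly poly ring"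
    by (rule face_primeideal[OF face_W])
  show ?thesis
    using P.rcos_ring_hom_ring by (simp add: quotient_map_def[abs_def])
qed

lemma quotient_map_eq_iff:
  fixes f g :: "'k::field mpoly poly"
  assumes "f \<in> supported S" "g \<in> supported S"
  shows "quotient_map f = quotient_map g \<longleftrightarrow> f - g \<in> supported (S - W)"
proof -
  interpret cring "monoid_algebra S :: 'k mpoly poly ring" by (rule cring_monoid_algebra)
  interpret P: primeideal "supported (S - W)" "monoid_algebra S :: 'k mpoly poly ring"
    by (rule face_primeideal[OF face_W])
  have "\<ominus>\<^bsub>monoid_algebra S\<^esub> g = - g"
    by (rule minus_equality) (use assms in \<open>auto intro: supported_closed\<close>)
  then have "f \<ominus>\<^bsub>monoid_algebra S\<^esub> g = f - g"
    by (simp add: a_minus_def)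
  then show ?thesis
    using quotient_eq_iff_same_a_r_cos[OF P.is_ideal, of f g] assms by (auto simp: quotient_map_def)
qed

text \<open>The part of a polynomial off \<open>W\<close> lies in the ideal that is divided out, so
  only the exponents in \<open>W\<close> matter.\<close>

lemma quotient_map_supported:
  assumes "T \<subseteq> S"
  shows "quotient_map ` (supported T :: 'k::field mpoly poly set) = quotient_map ` supported (T \<inter> W)"
proof (rule equalityI[OF subsetI image_mono[OF supported_mono]])
  fix y :: "'k mpoly poly set" assume "y \<in> quotient_map ` supported T"
  then obtain f where f: "f \<in> supported T" "y = quotient_map f" by auto
  obtain g h where gh: "f = g + h" "g \<in> supported (T \<inter> W)" "h \<in> supported (T - W)"
    by (rule supported_split[OF f(1)])
  have "g \<in> supported S" "f \<in> supported S" "h \<in> supported (S - W)"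
    using supported_mono[of "T \<inter> W" S] supported_mono[of "T - W" "S - W"] supported_mono[of T S] f gh assms by auto
  then have "quotient_map f = quotient_map g"
    by (subst quotient_map_eq_iff) (auto simp: gh(1))
  then show "y \<in> quotient_map ` supported (T \<inter> W)"
    using f gh by auto
qed auto

lemma one_not_zero_quotient: "\<one>\<^bsub>quotient\<^esub> \<noteq> \<zero>\<^bsub>quotient :: 'k::field mpoly poly set ring\<^esub>"
proof -
  have "domain (quotient :: 'k mpoly poly set ring)"
    by (rule primeideal.quotient_is_domain[OF face_primeideal[OF face_W]])
  then show ?thesis
    by (rule domain.one_not_zero)
qed

lemma subfield_quotient: "subfield (quotient_map ` scalars) (quotient :: 'k::field mpoly poly set ring)"
  by (rule ring_hom_ring.img_is_subfield(2)[OF quotient_hom subfield_scalars one_not_zero_quotient])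

text \<open>An element of the ideal that is supported in \<open>W\<close> has empty support. The
  quotient map is therefore injective on \<open>supported T\<close> and preserves its
  dimension.\<close>

lemma dimension_quotient:
  assumes "finite T" "T \<subseteq> W"
  shows "ring.dimension quotient (card T) (quotient_map ` (scalars :: 'k::field mpoly poly set))
    (quotient_map ` supported T)"
proof (rule ring_hom_ring.inj_hom_dimension[OF quotient_hom subfield_scalars one_not_zero_quotient])
  have "T \<subseteq> S"
    using assms face_W by (auto simp: face_def)
  then show "ring.dimension (monoid_algebra S) (card T) scalars (supported T :: 'k mpoly poly set)"
    by (rule dimension_supported(1)[OF assms(1)])
  show "inj_on quotient_map (supported T :: 'k mpoly poly set)"
  proof (rule inj_onI)
    fix f g :: "'k mpoly poly"
    assume fg: "f \<in> supported T" "g \<in> supported T" "quotient_map f = quotient_map g"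
    then have "f - g \<in> supported (S - W)"
      using quotient_map_eq_iff[of f g] supported_mono[OF \<open>T \<subseteq> S\<close>] by auto
    moreover have "f - g \<in> supported T"
      using supported_closed(2)[OF fg(1) supported_closed(3)[OF fg(2)]] by simp
    ultimately have "f - g \<in> supported ((S - W) \<inter> T)"
      by (rule supported_Int)
    moreover have "(S - W) \<inter> T = {}"
      using assms by blast
    ultimately show "f = g"
      by (simp add: supported_empty)
  qed
qed

text \<open>The chain of faces starts at \<open>W\<close>, so the corresponding primes all contain
  the ideal that is divided out and stay prime and distinct in the quotient.\<close>

lemma krull_dim_quotient:
  assumes fil: "\<And>i. finite (T i)" "\<And>i. card (T i) \<le> (i + 1) ^ d" "mono T" "(\<Union>i. T i) = W" "0 \<in> T 0"
    "\<And>i j s t. s \<in> T i \<Longrightarrow> t \<in> T j \<Longrightarrow> s + t \<in> T (i + j)"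
    and Z: "\<And>i. i \<le> d \<Longrightarrow> face (Z i)" "\<And>i. i < d \<Longrightarrow> Z (Suc i) \<subset> Z i" "Z 0 = W"
  shows "krull_dim (quotient :: 'k::field mpoly poly set ring) = enat d"
proof -
  interpret A: cring "monoid_algebra S :: 'k mpoly poly ring" by (rule cring_monoid_algebra)
  interpret P: primeideal "supported (S - W)" "monoid_algebra S :: 'k mpoly poly ring"
    by (rule face_primeideal[OF face_W])
  interpret Q: cring "quotient :: 'k mpoly poly set ring"
    by (rule P.quotient_is_cring[OF A.is_cring])
  interpret hom: ring_hom_ring "monoid_algebra S :: 'k mpoly poly ring" quotient quotient_map
    by (rule quotient_hom)
  have TW: "T i \<subseteq> W" for i
    using fil(4) by auto
  have WS: "W \<subseteq> S"
    using face_W by (auto simp: face_def)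
  have TS: "(supported (T i) :: 'k mpoly poly set) \<subseteq> supported S" for i
    using TW WS by (intro supported_mono) blast
  have ZW: "Z i \<subseteq> W" if "i \<le> d" for i
    using that
  proof (induction i)
    case (Suc i)
    then show ?case
      using Z(2)[of i] by auto
  qed (simp add: Z(3))
  have Zprime: "primeideal (supported (S - Z i)) (monoid_algebra S :: 'k mpoly poly ring)" if "i \<le> d" for i
    using face_primeideal Z(1)[OF that] .
  have Zsub: "supported (S - W) \<subseteq> (supported (S - Z i) :: 'k mpoly poly set)" if "i \<le> d" for i
    using ZW[OF that] by (intro supported_mono) auto
  show ?thesis
  proof (rule Q.krull_dim_eq[OF subfield_quotient, where V = "\<lambda>i. quotient_map ` supported (T i)" and
        P = "\<lambda>i. quotient_map ` supported (S - Z i)"])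
    fix i j and x y :: "'k mpoly poly set" 
    assume "x \<in> quotient_map ` supported (T i)" "y \<in> quotient_map ` supported (T j)"
    then obtain f g where fg: "f \<in> supported (T i)" "x = quotient_map f" "g \<in> supported (T j)" "y = quotient_map g"
      by auto
    then have "x \<otimes>\<^bsub>quotient\<^esub> y = quotient_map (f * g)"
      using hom.hom_mult[of f g] TS by auto
    then show "x \<otimes>\<^bsub>quotient\<^esub> y \<in> quotient_map ` supported (T (i + j))"
      using supported_mult[OF fg(1,3) fil(6)] by auto
  next
    show "mono (\<lambda>i. quotient_map ` supported (T i) :: 'k mpoly poly set set)"
      using fil(3) by (intro monoI image_mono supported_mono) (auto dest: monoD)
    have "quotient_map (1 :: 'k mpoly poly) = \<one>\<^bsub>quotient\<^esub>"
      using hom.hom_one by simp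
    then show "\<one>\<^bsub>quotient\<^esub> \<in> quotient_map ` (supported (T 0) :: 'k mpoly poly set)"
      using scalar_supported[OF fil(5), of 1] by (metis image_eqI scalar_simps(2))
    show "carrier quotient \<subseteq> (\<Union>i. quotient_map ` (supported (T i) :: 'k mpoly poly set))"
    proof
      fix x :: "'k mpoly poly set" assume "x \<in> carrier quotient"
      then obtain f where "f \<in> supported S" "x = quotient_map f"
        unfolding FactRing_def A_RCOSETS_def' quotient_map_def by auto
      then have "x \<in> quotient_map ` supported (S \<inter> W)"
        using quotient_map_supported[of S] by blast
      then obtain f where f: "f \<in> supported W" "x = quotient_map f"
        using WS by (auto simp: Int_absorb1)
      have "f \<in> supported (\<Union>i. T i)"
        using f(1) fil(4) by simp
      then obtain i where "f \<in> supported (T i)"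
        by (rule supported_UN_mono[OF fil(3)])
      then show "x \<in> (\<Union>i. quotient_map ` supported (T i))"
        using f by auto
    qed
    show "\<exists>m\<le>(i + 1) ^ d. Q.dimension m (quotient_map ` (scalars :: 'k mpoly poly set)) (quotient_map ` supported (T i))" for i
      using dimension_quotient[of "T i"] fil(1,2) TW by blast
    show "primeideal (quotient_map ` supported (S - Z i)) (quotient :: 'k mpoly poly set ring)" if "i \<le> d" for i
      unfolding quotient_map_def[abs_def] by (rule A.quotient_primeideal[OF P.is_ideal Zprime Zsub]) (use that in auto)
    show "quotient_map ` supported (S - Z i) \<subset> (quotient_map ` supported (S - Z (Suc i)) :: 'k mpoly poly set set)"
      if "i < d" for i
    proof -
      have "\<exists>s. s \<in> Z i \<and> s \<notin> Z (Suc i)"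
        using Z(2)[OF that] by blast
      then obtain s where s: "s \<in> Z i" "s \<notin> Z (Suc i)"
        by blast
      have "s \<in> S"
        using Z(1)[of i] s that by (auto simp: face_def)
      then have m: "(monomial s :: 'k mpoly poly) \<in> supported (S - Z (Suc i))"
          "(monomial s :: 'k mpoly poly) \<notin> supported (S - Z i)" "(monomial s :: 'k mpoly poly) \<in> supported S"
        using s by (simp_all add: monomial_supported)
      have "ideal (supported (S - Z i)) (monoid_algebra S :: 'k mpoly poly ring)"
        using Zprime[of i] that by (simp add: primeideal_def)
      then have "quotient_map (monomial s :: 'k mpoly poly) \<notin> quotient_map ` supported (S - Z i)"
        using A.rcoset_mem_image_iff[OF P.is_ideal _ Zsub, of i "monomial s"] m that
        by (simp add: quotient_map_def[abs_def])
      moreover have "supported (S - Z i) \<subseteq> (supported (S - Z (Suc i)) :: 'k mpoly poly set)"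
        using Z(2)[OF that] by (intro supported_mono) auto
      ultimately show ?thesis
        using m(1) by blast
    qed
  qed
qed

end

section \<open>Covers of the bipartite graph of a poset\<close>

abbreviation xexp :: "mon \<Rightarrow> nat \<Rightarrow> nat" where
  "xexp s i \<equiv> Poly_Mapping.lookup (fst s) (VX i)"

abbreviation yexp :: "mon \<Rightarrow> nat \<Rightarrow> nat" where
  "yexp s i \<equiv> Poly_Mapping.lookup (fst s) (VY i)"

definition indicator_exp :: "vertex set \<Rightarrow> vertex \<Rightarrow>\<^sub>0 nat" where
  "indicator_exp C = (\<Sum>v\<in>C. Poly_Mapping.single v 1)"

lemma lookup_indicator_exp:
  "finite C \<Longrightarrow> Poly_Mapping.lookup (indicator_exp C) v = (if v \<in> C then 1 else 0)"
  by (simp add: indicator_exp_def lookup_sum lookup_single when_def)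

lemma prod_var: "(\<Prod>v\<in>C. var v) = Poly_Mapping.single (indicator_exp C) (1 :: 'k::field)"
  by (induction C rule: infinite_finite_induct)
    (auto simp: indicator_exp_def var_def mult_single)

lemma var_eq_monomial: "[:var v:] = (monomial (Poly_Mapping.single v 1, 0) :: 'k::field mpoly poly)"
  by (simp add: monomial_def cover_monomial_def var_def monom_0)

lemma monom_prod_var:
  "Polynomial.monom (\<Prod>v\<in>C. var v) 1 = (monomial (indicator_exp C, 1) :: 'k::field mpoly poly)"
  by (simp add: monomial_def cover_monomial_def prod_var)

lemma bounded_exponents:
  assumes "finite V"
  shows "finite {c :: vertex \<Rightarrow>\<^sub>0 nat. Poly_Mapping.keys c \<subseteq> V \<and> (\<forall>v. Poly_Mapping.lookup c v \<le> N)}" (is "finite ?E")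
    and "card {c :: vertex \<Rightarrow>\<^sub>0 nat. Poly_Mapping.keys c \<subseteq> V \<and> (\<forall>v. Poly_Mapping.lookup c v \<le> N)} \<le> (N + 1) ^ card V"
proof -
  have inj: "inj_on (\<lambda>c. restrict (Poly_Mapping.lookup c) V) ?E"
  proof (rule inj_onI)
    fix c d :: "vertex \<Rightarrow>\<^sub>0 nat"
    assume cd: "c \<in> ?E" "d \<in> ?E" and eq: "restrict (Poly_Mapping.lookup c) V = restrict (Poly_Mapping.lookup d) V"
    show "c = d"
    proof (rule poly_mapping_eqI)
      fix v
      show "Poly_Mapping.lookup c v = Poly_Mapping.lookup d v"
      proof (cases "v \<in> V")
        case True
        then show ?thesis using fun_cong[OF eq, of v] by simp
      next
        case False
        then show ?thesis using cd by (metis (mono_tags, lifting) in_keys_iff mem_Collect_eq subsetD)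
      qed
    qed
  qed
  have sub: "(\<lambda>c. restrict (Poly_Mapping.lookup c) V) ` ?E \<subseteq> (V \<rightarrow>\<^sub>E {..N})"
    by auto
  have fin: "finite (V \<rightarrow>\<^sub>E {..N})"
    using assms by (intro finite_PiE) auto
  show "finite ?E"
    using inj_on_finite[OF inj sub fin] .
  show "card ?E \<le> (N + 1) ^ card V"
    using card_inj_on_le[OF inj sub fin] assms by (simp add: card_PiE)
qed

lemma monoid_algebra_mult: "(\<otimes>\<^bsub>monoid_algebra S\<^esub>) = (*)"
  by (intro ext) simp

text \<open>The index set is an arbitrary finite set of numbers, so that the same results apply to
  the whole poset and to each induced subposet.\<close>

locale labelled_poset =
  fixes p :: "nat \<Rightarrow> 'a" and r :: "'a rel" and F :: "nat set"
  assumes finite_F [simp]: "finite F"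
    and reflexive: "i \<in> F \<Longrightarrow> (p i, p i) \<in> r"
    and transitive: "i \<in> F \<Longrightarrow> j \<in> F \<Longrightarrow> l \<in> F \<Longrightarrow> (p i, p j) \<in> r \<Longrightarrow> (p j, p l) \<in> r \<Longrightarrow> (p i, p l) \<in> r"
    and label: "i \<in> F \<Longrightarrow> j \<in> F \<Longrightarrow> (p i, p j) \<in> r \<Longrightarrow> i \<le> j"
begin

abbreviation G :: graph where "G \<equiv> poset_graph p r F"

definition covers :: "mon set" where
  "covers = {s. is_k_cover G (snd s) (fst s)}"

lemma edge_iff: "{v, w} \<in> snd G \<longleftrightarrow>
    (\<exists>i\<in>F. \<exists>j\<in>F. (p i, p j) \<in> r \<and> (v = VX i \<and> w = VY j \<or> v = VY j \<and> w = VX i))"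
  by (auto simp: poset_graph_def doubleton_eq_iff)

lemma vertices: "fst G = VX ` F \<union> VY ` F"
  by (simp add: poset_graph_def)

lemma covers_iff: "s \<in> covers \<longleftrightarrow> Poly_Mapping.keys (fst s) \<subseteq> fst G \<and>
    (\<forall>i\<in>F. \<forall>j\<in>F. (p i, p j) \<in> r \<longrightarrow> snd s \<le> xexp s i + yexp s j)"
proof
  assume "s \<in> covers"
  then have "Poly_Mapping.keys (fst s) \<subseteq> fst G"
      "\<And>v w. {v, w} \<in> snd G \<Longrightarrow> snd s \<le> Poly_Mapping.lookup (fst s) v + Poly_Mapping.lookup (fst s) w"
    unfolding covers_def is_k_cover_def by auto
  then show "Poly_Mapping.keys (fst s) \<subseteq> fst G \<and>
    (\<forall>i\<in>F. \<forall>j\<in>F. (p i, p j) \<in> r \<longrightarrow> snd s \<le> xexp s i + yexp s j)"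
    unfolding edge_iff by blast
next
  assume *: "Poly_Mapping.keys (fst s) \<subseteq> fst G \<and>
    (\<forall>i\<in>F. \<forall>j\<in>F. (p i, p j) \<in> r \<longrightarrow> snd s \<le> xexp s i + yexp s j)"
  then show "s \<in> covers"
    unfolding covers_def is_k_cover_def edge_iff by (auto simp: add.commute)
qed

lemma lookup_eq_0: "s \<in> covers \<Longrightarrow> v \<notin> fst G \<Longrightarrow> Poly_Mapping.lookup (fst s) v = 0"
  using in_keys_iff[of v "fst s"] by (auto simp: covers_iff)

lemma covers_eqI:
  assumes "s \<in> covers" "t \<in> covers" "snd s = snd t"
    and "\<And>i. i \<in> F \<Longrightarrow> xexp s i = xexp t i" "\<And>i. i \<in> F \<Longrightarrow> yexp s i = yexp t i"
  shows "s = t"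
proof (rule prod_eqI)
  show "fst s = fst t"
  proof (rule poly_mapping_eqI)
    fix v show "Poly_Mapping.lookup (fst s) v = Poly_Mapping.lookup (fst t) v"
      using assms lookup_eq_0[of s v] lookup_eq_0[of t v] by (cases "v \<in> fst G") (auto simp: vertices)
  qed
qed (rule assms)

lemma coversD: "s \<in> covers \<Longrightarrow> i \<in> F \<Longrightarrow> snd s \<le> xexp s i + yexp s i"
  using reflexive by (auto simp: covers_iff)

sublocale submonoid covers
proof
  show "0 \<in> covers"
    by (simp add: covers_iff)
  show "s + t \<in> covers" if "s \<in> covers" "t \<in> covers" for s t
  proof -
    have "Poly_Mapping.keys (fst s + fst t) \<subseteq> fst G"
      using that Poly_Mapping.keys_add[of "fst s" "fst t"] by (auto simp: covers_iff)
    moreover have "snd s + snd t \<le> (xexp s i + xexp t i) + (yexp s j + yexp t j)"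
      if "i \<in> F" "j \<in> F" "(p i, p j) \<in> r" for i j
    proof -
      have "snd s \<le> xexp s i + yexp s j" "snd t \<le> xexp t i + yexp t j"
        using that \<open>s \<in> covers\<close> \<open>t \<in> covers\<close> unfolding covers_iff by blast+
      then show ?thesis by linarith
    qed
    ultimately show ?thesis
      by (simp add: covers_iff lookup_add)
  qed
qed

text \<open>Covers form a monoid, so the polynomials supported on them already form a ring.
  Conversely such a polynomial is a finite sum of scalars times cover monomials.\<close>

lemma vertex_cover_algebra_eq:
  "vertex_cover_algebra G = (monoid_algebra covers :: 'k::field mpoly poly ring)"
proof -
  interpret ring "ambient :: 'k mpoly poly ring"
    using cring_ambient by (rule cring.axioms(1))
  let ?H = "scalars \<union> {cover_monomial c k |c k. is_k_cover G k c} :: 'k mpoly poly set"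
  have "{cover_monomial c k |c k. is_k_cover G k c} = (monomial ` covers :: 'k mpoly poly set)"
    by (fastforce simp: covers_def monomial_def image_iff)
  then have H: "?H = scalars \<union> monomial ` covers"
    by simp
  have "generate_ring ambient ?H = supported covers"
  proof (rule equalityI)
    show "generate_ring ambient ?H \<subseteq> supported covers"
    proof (rule generate_ring_min_subring1)
      show "subring (supported covers) (ambient :: 'k mpoly poly ring)"
        using subcring_supported by (rule subcring.axioms(1))
      show "?H \<subseteq> supported covers"
        unfolding H by (auto simp: scalars_eq scalar_supported zero_mem monomial_supported)
    qed (simp add: ambient_simps)
    show "supported covers \<subseteq> generate_ring ambient ?H"
    proof
      fix f :: "'k mpoly poly" assume f: "f \<in> supported covers"
      have sum: "(\<Sum>s\<in>A. scalar (mcoeff f s) * monomial s) \<in> generate_ring ambient ?H"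
        if "finite A" "A \<subseteq> covers" for A
        using that
      proof (induction A rule: finite_induct)
        case empty
        show ?case
          using zero_in_generate[of ?H] by (simp add: ambient_simps)
      next
        case (insert s A)
        have "scalar (mcoeff f s) \<in> generate_ring ambient ?H" "monomial s \<in> generate_ring ambient ?H"
          using insert.prems unfolding H by (auto intro!: generate_ring.incl simp: scalars_eq)
        then have "scalar (mcoeff f s) * monomial s \<in> generate_ring ambient ?H"
          using generate_ring.eng_mult[of _ "ambient :: 'k mpoly poly ring"] by (simp only: ambient_simps)
        moreover have "(\<Sum>s\<in>A. scalar (mcoeff f s) * monomial s) \<in> generate_ring ambient ?H"
          using insert by auto
        ultimately show ?case
          using generate_ring.eng_add[of _ "ambient :: 'k mpoly poly ring"] insert(1,2)
          by (simp add: ambient_simps)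
      qed
      show "f \<in> generate_ring ambient ?H"
        by (subst mcoeff_expand[OF finite_mcoeff order_refl], rule sum[OF finite_mcoeff])
          (use supportedD[OF f] in blast)
    qed
  qed
  then show ?thesis
    by (simp add: vertex_cover_algebra_def monoid_algebra_def)
qed

section \<open>Minimal vertex covers and downsets\<close>

definition downset :: "nat set \<Rightarrow> bool" where
  "downset I \<longleftrightarrow> I \<subseteq> F \<and> (\<forall>i\<in>F. \<forall>j\<in>I. (p i, p j) \<in> r \<longrightarrow> i \<in> I)"

definition downset_cover :: "nat set \<Rightarrow> vertex set" where
  "downset_cover I = VX ` I \<union> VY ` (F - I)"

lemma vertex_cover_iff: "vertex_cover G C \<longleftrightarrow> C \<subseteq> fst G \<and>
    (\<forall>i\<in>F. \<forall>j\<in>F. (p i, p j) \<in> r \<longrightarrow> VX i \<in> C \<or> VY j \<in> C)"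
  unfolding vertex_cover_def by (auto simp: poset_graph_def)

lemma vertex_cover_downset_cover: "downset I \<Longrightarrow> vertex_cover G (downset_cover I)"
  unfolding vertex_cover_iff downset_def downset_cover_def vertices by blast

text \<open>Every cover contains the cover of a downset: take the indices all of whose lower indices
  \<open>j\<close> have \<open>VX j\<close> in the cover; at any other index \<open>i\<close> an
  edge forces \<open>VY i\<close>. Covers of downsets are minimal since they contain just one end of
  each edge \<open>{VX i, VY i}\<close>.\<close>

lemma minimal_vertex_cover_iff: "minimal_vertex_cover G C \<longleftrightarrow> (\<exists>I. downset I \<and> C = downset_cover I)"
proof
  assume C: "minimal_vertex_cover G C"
  define I where "I = {i \<in> F. \<forall>j\<in>F. (p j, p i) \<in> r \<longrightarrow> VX j \<in> C}"
  have I: "downset I"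
    unfolding downset_def I_def using transitive by blast
  have vc: "vertex_cover G C"
    using C by (simp add: minimal_vertex_cover_def)
  have "VY i \<in> C" if "i \<in> F - I" for i
    using that vc unfolding vertex_cover_iff I_def by auto
  moreover have "VX i \<in> C" if "i \<in> I" for i
    using that reflexive unfolding I_def by auto
  ultimately have "downset_cover I \<subseteq> C"
    unfolding downset_cover_def by auto
  then have "C = downset_cover I"
    using C vertex_cover_downset_cover[OF I] unfolding minimal_vertex_cover_def by blast
  then show "\<exists>I. downset I \<and> C = downset_cover I"
    using I by blast
next
  assume "\<exists>I. downset I \<and> C = downset_cover I"
  then obtain I where I: "downset I" "C = downset_cover I" by blast
  have "downset_cover I \<subseteq> D" if D: "D \<subseteq> downset_cover I" "vertex_cover G D" for D
  proof
    fix v assume v: "v \<in> downset_cover I"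
    then obtain i where i: "i \<in> F" "v = VX i \<and> i \<in> I \<or> v = VY i \<and> i \<notin> I"
      using I(1) by (auto simp: downset_cover_def downset_def)
    then have "VX i \<in> D \<or> VY i \<in> D"
      using D(2) reflexive unfolding vertex_cover_iff by blast
    then show "v \<in> D"
      using D(1) i by (auto simp: downset_cover_def)
  qed
  then show "minimal_vertex_cover G C"
    using I vertex_cover_downset_cover[OF I(1)] unfolding minimal_vertex_cover_def by blast
qed

definition downset_exp :: "nat set \<Rightarrow> mon" where
  "downset_exp I = (indicator_exp (downset_cover I), 1)"

definition var_exp :: "vertex \<Rightarrow> mon" where
  "var_exp v = (Poly_Mapping.single v 1, 0)"

lemma finite_downset_cover: "I \<subseteq> F \<Longrightarrow> finite (downset_cover I)"
  unfolding downset_cover_def using finite_subset[of I F] by auto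

lemma downset_cover_mem: "VX i \<in> downset_cover I \<longleftrightarrow> i \<in> I" "VY i \<in> downset_cover I \<longleftrightarrow> i \<in> F - I"
  by (auto simp: downset_cover_def)

lemma downset_exp_simps:
  assumes "I \<subseteq> F" "i \<in> F"
  shows "xexp (downset_exp I) i = (if i \<in> I then 1 else 0)"
    and "yexp (downset_exp I) i = (if i \<in> I then 0 else 1)"
  using assms by (simp_all add: downset_exp_def lookup_indicator_exp finite_downset_cover downset_cover_mem)

lemma snd_downset_exp [simp]: "snd (downset_exp I) = 1"
  by (simp add: downset_exp_def)

lemma snd_var_exp [simp]: "snd (var_exp v) = 0"
  by (simp add: var_exp_def)

lemma lookup_var_exp: "Poly_Mapping.lookup (fst (var_exp v)) w = (if v = w then 1 else 0)"
  by (simp add: var_exp_def lookup_single when_def)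

lemma downset_exp_covers: "downset I \<Longrightarrow> downset_exp I \<in> covers"
proof -
  assume I: "downset I"
  then have sub: "I \<subseteq> F" by (simp add: downset_def)
  have "v \<in> fst G" if "v \<in> Poly_Mapping.keys (indicator_exp (downset_cover I))" for v
  proof -
    have "v \<in> downset_cover I"
      using that sub by (simp add: in_keys_iff lookup_indicator_exp finite_downset_cover split: if_splits)
    then show ?thesis
      using sub by (auto simp: downset_cover_def vertices)
  qed
  then show ?thesis
    using I downset_exp_simps[OF sub] unfolding covers_iff by (auto simp: downset_exp_def downset_def)
qed

lemma var_exp_covers: "v \<in> fst G \<Longrightarrow> var_exp v \<in> covers"
  by (simp add: covers_iff var_exp_def)

section \<open>Generators of the monoid of covers and the grading\<close>

definition gens :: "mon set" where
  "gens = var_exp ` fst G \<union> downset_exp ` {I. downset I}"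

lemma degree_one_generators_eq: "(degree_one_generators G :: 'k::field mpoly poly set) = monomial ` gens"
proof -
  have "{Polynomial.monom (\<Prod>v\<in>C. var v) 1 | C. minimal_vertex_cover G C} =
      (monomial ` downset_exp ` {I. downset I} :: 'k mpoly poly set)"
    unfolding minimal_vertex_cover_iff monom_prod_var by (auto simp: downset_exp_def)
  moreover have "{[:var v:] | v. v \<in> fst G} = (monomial ` var_exp ` fst G :: 'k mpoly poly set)"
    by (auto simp: var_eq_monomial var_exp_def)
  ultimately show ?thesis
    by (simp add: degree_one_generators_def gens_def image_Un)
qed

lemma gens_covers: "gens \<subseteq> covers"
  by (auto simp: gens_def var_exp_covers downset_exp_covers)

text \<open>On covers the truncated subtraction does not truncate, by \<open>coversD\<close>.\<close>

definition deg :: "mon \<Rightarrow> nat" where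
  "deg s = snd s + (\<Sum>i\<in>F. xexp s i + yexp s i - snd s)"

lemma deg_0 [simp]: "deg 0 = 0"
  by (simp add: deg_def)

lemma deg_add:
  assumes "s \<in> covers" "t \<in> covers"
  shows "deg (s + t) = deg s + deg t"
proof -
  have "(\<Sum>i\<in>F. xexp (s + t) i + yexp (s + t) i - snd (s + t)) =
      (\<Sum>i\<in>F. (xexp s i + yexp s i - snd s) + (xexp t i + yexp t i - snd t))"
    using coversD[OF assms(1)] coversD[OF assms(2)] by (intro sum.cong) (auto simp: lookup_add)
  then show ?thesis
    by (simp add: deg_def sum.distrib)
qed

lemma deg_gens: "s \<in> gens \<Longrightarrow> deg s = 1"
proof -
  have "deg (downset_exp I) = 1" if "downset I" for I
    using that downset_exp_simps[of I] by (simp add: deg_def downset_def)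
  moreover have "deg (var_exp v) = 1" if "v \<in> fst G" for v
    using that by (auto simp: deg_def lookup_var_exp vertices sum.delta)
  ultimately show "s \<in> gens \<Longrightarrow> deg s = 1"
    by (auto simp: gens_def)
qed

text \<open>Subtraction of exponents truncates at zero. The bounds on \<open>t\<close> make it exact
  on the order and on the vertices of the graph, and elsewhere \<open>t\<close> vanishes;
  \<open>edge\<close> is the cover condition for the difference.\<close>

lemma covers_minus:
  assumes s: "s \<in> covers" and t: "t \<in> gens" and "snd t \<le> snd s"
    and le: "\<And>v. v \<in> fst G \<Longrightarrow> Poly_Mapping.lookup (fst t) v \<le> Poly_Mapping.lookup (fst s) v"
    and edge: "\<And>i j. i \<in> F \<Longrightarrow> j \<in> F \<Longrightarrow> (p i, p j) \<in> r \<Longrightarrow>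
      snd s - snd t \<le> (xexp s i - xexp t i) + (yexp s j - yexp t j)"
  shows "s - t \<in> covers" "s = t + (s - t)"
proof -
  have le': "Poly_Mapping.lookup (fst t) v \<le> Poly_Mapping.lookup (fst s) v" for v
    using le[of v] lookup_eq_0[of t v] t gens_covers by (cases "v \<in> fst G") auto
  have "Poly_Mapping.keys (fst s - fst t) \<subseteq> Poly_Mapping.keys (fst s)"
    by (auto simp: in_keys_iff lookup_minus)
  then show "s - t \<in> covers"
    using s edge by (auto simp: covers_iff lookup_minus)
  show "s = t + (s - t)"
    using \<open>snd t \<le> snd s\<close> le' by (intro prod_eqI poly_mapping_eqI) (simp_all add: lookup_add lookup_minus)
qed

text \<open>Subtracting the cover of the downset on which every lower \<open>x\<close>-exponent is positive lowers the order of a cover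
  by one.\<close>

lemma covers_decompose:
  assumes s: "s \<in> covers" "s \<noteq> 0"
  obtains g t where "g \<in> gens" "t \<in> covers" "s = g + t"
proof (cases "snd s = 0")
  \<comment> \<open>In order zero the edge conditions are vacuous, so any variable in the support
    can be split off.\<close>
  case True
  then have "fst s \<noteq> 0"
    using s(2) by (auto simp: prod_eq_iff)
  then obtain v where v: "Poly_Mapping.lookup (fst s) v \<noteq> 0"
    using poly_mapping_eqI[of "fst s" 0] by auto
  have vG: "v \<in> fst G"
    using lookup_eq_0[OF s(1), of v] v by fast
  have g: "var_exp v \<in> gens"
    using vG by (simp add: gens_def)
  show ?thesis
    by (rule that[OF g covers_minus[OF s(1) g]])
       (use v True in \<open>auto simp: lookup_var_exp\<close>)
next
  case False
  define I where "I = {i \<in> F. \<forall>j\<in>F. (p j, p i) \<in> r \<longrightarrow> 1 \<le> xexp s j}"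
  have I: "downset I"
    unfolding downset_def I_def using transitive by blast
  have sub: "I \<subseteq> F"
    by (auto simp: I_def)
  have g: "downset_exp I \<in> gens"
    using I by (auto simp: gens_def)
  have x: "1 \<le> xexp s i" if "i \<in> I" for i
    using that reflexive by (auto simp: I_def)
  \<comment> \<open>Outside \<open>I\<close> some lower \<open>x\<close>-exponent is zero, so its
    edge to \<open>VY i\<close> puts the full order on \<open>yexp s i\<close>. This settles the
    critical edges \<open>{VX i, VY j}\<close> with \<open>i\<close> in \<open>I\<close> and
    \<open>j\<close> outside, where both ends lose one while the order drops only by one.\<close>
  have y: "snd s \<le> yexp s i" if i: "i \<in> F" "i \<notin> I" for i
  proof -
    obtain j where "j \<in> F" "(p j, p i) \<in> r" "xexp s j = 0"
      using i by (auto simp: I_def)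
    then show ?thesis
      using s(1) i(1) by (auto simp: covers_iff)
  qed
  have "snd (downset_exp I) \<le> snd s"
    using False by simp
  moreover have "Poly_Mapping.lookup (fst (downset_exp I)) v \<le> Poly_Mapping.lookup (fst s) v" if "v \<in> fst G" for v
  proof -
    obtain i where i: "i \<in> F" "v = VX i \<or> v = VY i"
      using \<open>v \<in> fst G\<close> by (auto simp: vertices)
    then show ?thesis
      using downset_exp_simps[OF sub i(1)] x[of i] y[of i] False by auto
  qed
  moreover have "snd s - snd (downset_exp I) \<le>
      (xexp s i - xexp (downset_exp I) i) + (yexp s j - yexp (downset_exp I) j)"
    if "i \<in> F" "j \<in> F" "(p i, p j) \<in> r" for i j
  proof -
    have "snd s \<le> xexp s i + yexp s j"
      using s(1) that by (auto simp: covers_iff)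
    moreover have "j \<in> I \<Longrightarrow> i \<in> I"
      using I that by (auto simp: downset_def)
    ultimately show ?thesis
      using downset_exp_simps[OF sub that(1)] downset_exp_simps[OF sub that(2)] x[of i] y[of j] that
      by auto
  qed
  ultimately show ?thesis
    using that[OF g covers_minus[OF s(1) g]] by blast
qed

text \<open>\<open>deg\<close> is additive and equals 1 on generators, so it counts the factors of a
  product. Conversely \<open>covers_decompose\<close> removes one generator at a time until degree
  zero, where only the cover \<open>0\<close> is left.\<close>

lemma degree_products_eq:
  "degree_products (monoid_algebra covers) (degree_one_generators G) d =
    (monomial ` {s \<in> covers. deg s = d} :: 'k::field mpoly poly set)"
proof (rule equalityI)
  have "\<exists>s\<in>covers. deg s = length gs \<and> foldr (*) gs 1 = monomial s"
    if "set gs \<subseteq> monomial ` gens" for gs :: "'k mpoly poly list"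
    using that
  proof (induction gs)
    case Nil
    show ?case
      by (rule bexI[of _ 0]) (simp_all add: monomial_0 zero_mem)
  next
    case (Cons x gs)
    then obtain s where s: "s \<in> covers" "deg s = length gs"
        "foldr (*) gs 1 = (monomial s :: 'k mpoly poly)"
      by auto
    obtain g where g: "g \<in> gens" "x = monomial g"
      using Cons.prems by auto
    then have "g \<in> covers" "deg g = 1"
      using gens_covers deg_gens by blast+
    then show ?case
      using s g(2) by (intro bexI[of _ "g + s"]) (simp_all add: monomial_add deg_add add_mem)
  qed
  then show "degree_products (monoid_algebra covers) (degree_one_generators G) d \<subseteq>
      (monomial ` {s \<in> covers. deg s = d} :: 'k mpoly poly set)"
    unfolding degree_products_def degree_one_generators_eq monoid_algebra_mult monoid_algebra_simps
    by fastforce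
  have "\<exists>gs. set gs \<subseteq> monomial ` gens \<and> length gs = d \<and>
      foldr (*) gs 1 = (monomial s :: 'k mpoly poly)"
    if "s \<in> covers" "deg s = d" for s
    using that
  proof (induction d arbitrary: s)
    case 0
    have "s = 0"
    proof (rule ccontr)
      assume "s \<noteq> 0"
      then obtain g t where "g \<in> gens" "t \<in> covers" "s = g + t"
        using covers_decompose[OF 0(1)] by metis
      then show False
        using 0(2) deg_add[of g t] deg_gens[of g] gens_covers by auto
    qed
    then show ?case
      by (intro exI[of _ "[]"]) (simp add: monomial_0)
  next
    case (Suc d)
    then have "s \<noteq> 0" by auto
    then obtain g t where gt: "g \<in> gens" "t \<in> covers" "s = g + t"
      using covers_decompose[OF Suc.prems(1)] by metis
    then have "deg t = d"
      using Suc.prems(2) deg_add[of g t] deg_gens[of g] gens_covers by auto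
    then obtain gs where "set gs \<subseteq> monomial ` gens" "length gs = d"
        "foldr (*) gs 1 = (monomial t :: 'k mpoly poly)"
      using Suc.IH[OF gt(2)] by metis
    then show ?case
      using gt by (intro exI[of _ "monomial g # gs"]) (auto simp: monomial_add)
  qed
  then have "monomial s \<in> (degree_products (monoid_algebra covers) (degree_one_generators G) d :: 'k mpoly poly set)"
    if "s \<in> covers" "deg s = d" for s
    using that unfolding degree_products_def degree_one_generators_eq monoid_algebra_mult monoid_algebra_simps
    by (metis (mono_tags, lifting) mem_Collect_eq)
  then show "monomial ` {s \<in> covers. deg s = d} \<subseteq>
      (degree_products (monoid_algebra covers) (degree_one_generators G) d :: 'k mpoly poly set)"
    by blast
qed

lemma card_vertices: "card (fst G) = 2 * card F"
proof -
  have "card (VX ` F \<union> VY ` F) = card (VX ` F) + card (VY ` F)"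
    by (intro card_Un_disjoint) auto
  also have "\<dots> = 2 * card F"
    by (simp add: card_image inj_on_def)
  finally show ?thesis
    by (simp add: vertices)
qed

text \<open>A cover is given by \<open>2 * card F\<close> exponents and its order. The resulting
  power of \<open>N + 1\<close> is the upper bound for the Krull dimension.\<close>

lemma bounded_covers:
  "finite {s \<in> covers. snd s \<le> N \<and> (\<forall>v. Poly_Mapping.lookup (fst s) v \<le> N)}" (is "finite ?T")
  "card {s \<in> covers. snd s \<le> N \<and> (\<forall>v. Poly_Mapping.lookup (fst s) v \<le> N)} \<le> (N + 1) ^ (2 * card F + 1)"
proof -
  let ?E = "{c :: vertex \<Rightarrow>\<^sub>0 nat. Poly_Mapping.keys c \<subseteq> fst G \<and> (\<forall>v. Poly_Mapping.lookup c v \<le> N)}"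
  have fin: "finite (fst G)"
    by (simp add: vertices)
  have sub: "?T \<subseteq> ?E \<times> {..N}"
    by (auto simp: covers_iff)
  show "finite ?T"
    by (rule finite_subset[OF sub]) (simp add: bounded_exponents[OF fin])
  have "card ?T \<le> card (?E \<times> {..N})"
    by (rule card_mono[OF _ sub]) (simp add: bounded_exponents[OF fin])
  also have "\<dots> = card ?E * (N + 1)"
    by (simp add: card_cartesian_product)
  also have "\<dots> \<le> (N + 1) ^ (2 * card F) * (N + 1)"
    using bounded_exponents(2)[OF fin, of N] unfolding card_vertices by (rule mult_right_mono) simp
  also have "\<dots> = (N + 1) ^ (2 * card F + 1)"
    by simp
  finally show "card ?T \<le> (N + 1) ^ (2 * card F + 1)" .
qed

lemma finite_deg: "finite {s \<in> covers. deg s = d}"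
proof (rule finite_subset[OF _ bounded_covers(1)[of "2 * d"]], intro subsetI CollectI conjI allI)
  fix s assume s: "s \<in> {s \<in> covers. deg s = d}"
  then show "s \<in> covers" and k: "snd s \<le> 2 * d"
    by (auto simp: deg_def)
  fix v
  show "Poly_Mapping.lookup (fst s) v \<le> 2 * d"
  proof (cases "v \<in> fst G")
    case True
    then obtain i where i: "i \<in> F" "v = VX i \<or> v = VY i"
      by (auto simp: vertices)
    have "xexp s i + yexp s i - snd s \<le> (\<Sum>i\<in>F. xexp s i + yexp s i - snd s)"
      using i(1) by (intro member_le_sum) auto
    then have "xexp s i + yexp s i - snd s + snd s \<le> d"
      using s by (auto simp: deg_def)
    then have "xexp s i + yexp s i \<le> d" by linarith
    then show ?thesis
      using i(2) by auto
  next
    case False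
    then show ?thesis
      using lookup_eq_0 s by simp
  qed
qed

text \<open>There are only finitely many covers of degree \<open>d\<close>. A list of all their
  monomials has the largest span in the union that defines the component.\<close>

lemma cover_algebra_component_eq:
  "cover_algebra_component G d = (supported {s \<in> covers. deg s = d} :: 'k::field mpoly poly set)"
proof -
  interpret cring "monoid_algebra covers :: 'k mpoly poly ring" by (rule cring_monoid_algebra)
  let ?T = "{s \<in> covers. deg s = d}"
  have "Span scalars Us \<subseteq> (supported ?T :: 'k mpoly poly set)" if "set Us \<subseteq> monomial ` ?T" for Us
  proof -
    have "Us \<in> lists (monomial ` ?T)"
      using that by (simp only: lists_eq_set mem_Collect_eq)
    then obtain ts where ts: "ts \<in> lists ?T" "Us = map monomial ts"
      unfolding lists_image by blast
    then have sub: "set ts \<subseteq> ?T"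
      by (simp only: lists_eq_set mem_Collect_eq)
    then have "Span scalars Us = (supported (set ts) :: 'k mpoly poly set)"
      unfolding ts(2) by (intro dimension_supported(2)) auto
    then show ?thesis
      using supported_mono[OF sub] by simp
  qed
  moreover obtain ts where ts: "set ts = ?T"
    using finite_list[OF finite_deg] by metis
  then have "Span scalars (map monomial ts) = (supported ?T :: 'k mpoly poly set)"
    using dimension_supported(2)[of ?T ts] finite_deg by auto
  moreover have "set (map monomial ts) \<subseteq> (monomial ` ?T :: 'k mpoly poly set)"
    using ts by simp
  ultimately show ?thesis
    unfolding cover_algebra_component_def graded_component_def vertex_cover_algebra_eq degree_products_eq
    by (intro equalityI UN_least) (blast, metis (mono_tags, lifting) UN_upper mem_Collect_eq)
qed

lemma hilbert_A_eq:
  "hilbert_A TYPE('k::field) G = Abs_fps (\<lambda>d. of_nat (card {s \<in> covers. deg s = d}))"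
proof -
  interpret cring "monoid_algebra covers :: 'k mpoly poly ring" by (rule cring_monoid_algebra)
  have "dim scalars (supported {s \<in> covers. deg s = d} :: 'k mpoly poly set) = card {s \<in> covers. deg s = d}" for d
    using dimI[OF subfield_scalars dimension_supported(1)[OF finite_deg]] by (auto simp: over_def)
  then show ?thesis
    by (simp add: hilbert_A_def hilbert_series_def vertex_cover_algebra_eq cover_algebra_component_eq)
qed

section \<open>Faces of the monoid of covers and the basic cover algebra\<close>

definition tight :: "nat set \<Rightarrow> mon set" where
  "tight D = {s \<in> covers. \<forall>i\<in>D. xexp s i + yexp s i = snd s}"

definition tight_zero :: "nat set \<Rightarrow> mon set" where
  "tight_zero D = {s \<in> tight F. \<forall>i\<in>D. xexp s i = 0}"

text \<open>The excess of \<open>xexp s i + yexp s i\<close> over the order is additive and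
  nonnegative on covers, so it vanishes on a sum exactly when it vanishes on both summands. Taking
  \<open>D = F\<close> gives the basic cover algebra, smaller \<open>D\<close> the first faces of
  the flag.\<close>

lemma face_tight:
  assumes "D \<subseteq> F"
  shows "face (tight D)"
proof -
  have "s + t \<in> tight D \<longleftrightarrow> s \<in> tight D \<and> t \<in> tight D" if st: "s \<in> covers" "t \<in> covers" for s t
  proof -
    have "xexp (s + t) i + yexp (s + t) i = snd (s + t) \<longleftrightarrow>
        xexp s i + yexp s i = snd s \<and> xexp t i + yexp t i = snd t" if "i \<in> D" for i
      using coversD[OF st(1), of i] coversD[OF st(2), of i] that assms by (auto simp: lookup_add)
    then show ?thesis
      using st add_mem by (auto simp: tight_def)
  qed
  moreover have "0 \<in> tight D"
    using zero_mem by (simp add: tight_def)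
  ultimately show ?thesis
    unfolding face_def by (auto simp: tight_def)
qed

lemma face_tight_zero: "face (tight_zero D)"
proof -
  have "s + t \<in> tight_zero D \<longleftrightarrow> s \<in> tight_zero D \<and> t \<in> tight_zero D"
    if "s \<in> covers" "t \<in> covers" for s t
  proof -
    have "s + t \<in> tight F \<longleftrightarrow> s \<in> tight F \<and> t \<in> tight F"
      using face_tight[of F] that by (simp add: face_def)
    then show ?thesis
      by (auto simp: tight_zero_def lookup_add)
  qed
  moreover have "0 \<in> tight_zero D"
    using face_tight[of F] by (simp add: tight_zero_def face_def)
  moreover have "tight_zero D \<subseteq> covers"
    by (auto simp: tight_zero_def tight_def)
  ultimately show ?thesis
    unfolding face_def by blast
qed

lemma mon_add_eq_0_iff: "s + t = 0 \<longleftrightarrow> s = 0 \<and> t = (0 :: mon)"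
proof
  assume eq: "s + t = 0"
  have "Poly_Mapping.lookup (fst s) v + Poly_Mapping.lookup (fst t) v = 0" for v
    using arg_cong[OF eq, of "\<lambda>s. Poly_Mapping.lookup (fst s) v"] by (simp add: lookup_add)
  then have "fst s = 0" "fst t = 0"
    by (auto intro: poly_mapping_eqI)
  moreover have "snd s = 0" "snd t = 0"
    using arg_cong[OF eq, of snd] by simp_all
  ultimately show "s = 0 \<and> t = 0"
    by (simp add: prod_eq_iff)
qed simp

lemma face_zero: "face {0}"
  using zero_mem by (simp add: face_def mon_add_eq_0_iff)

sublocale face_quotient covers "tight F"
  by standard (rule face_tight[OF order_refl])

text \<open>At a vertex that cannot be lowered some edge is tight; if neither \<open>VX i\<close> nor \<open>VY i\<close> can be lowered, the two
  tight edges \<open>{VX i, VY j}\<close>, \<open>{VX l, VY i}\<close> and the edge \<open>{VX l, VY j}\<close> force \<open>{VX i, VY i}\<close> to be tight.\<close>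

lemma covers_not_tight_decompose:
  assumes s: "s \<in> covers" "s \<notin> tight F"
  obtains v t where "v \<in> fst G" "t \<in> covers" "s = var_exp v + t"
proof -
  note result = that
  obtain i where i: "i \<in> F" "snd s < xexp s i + yexp s i"
    using s coversD[OF s(1)] by (force simp: tight_def)
  have edge: "snd s \<le> xexp s j + yexp s l" if "j \<in> F" "l \<in> F" "(p j, p l) \<in> r" for j l
    using s(1) that by (auto simp: covers_iff)
  have lower: thesis
    if v: "v \<in> fst G" "Poly_Mapping.lookup (fst s) v \<noteq> 0"
      and e: "\<And>j l. j \<in> F \<Longrightarrow> l \<in> F \<Longrightarrow> (p j, p l) \<in> r \<Longrightarrow>
        snd s \<le> (xexp s j - xexp (var_exp v) j) + (yexp s l - yexp (var_exp v) l)" for v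
  proof -
    have g: "var_exp v \<in> gens"
      using v by (simp add: gens_def)
    have "s - var_exp v \<in> covers \<and> s = var_exp v + (s - var_exp v)"
    proof -
      have "Poly_Mapping.lookup (fst (var_exp v)) w \<le> Poly_Mapping.lookup (fst s) w" for w
        using v(2) by (auto simp: lookup_var_exp)
      then show ?thesis
        using covers_minus[OF s(1) g] e by simp
    qed
    then show thesis
      using result[OF v(1)] by blast
  qed
  show thesis
  proof (cases "xexp s i \<noteq> 0 \<and> (\<forall>j\<in>F. (p i, p j) \<in> r \<longrightarrow> snd s < xexp s i + yexp s j)")
    case True
    show thesis
    proof (rule lower[of "VX i"])
      fix j l assume jl: "j \<in> F" "l \<in> F" "(p j, p l) \<in> r"
      show "snd s \<le> (xexp s j - xexp (var_exp (VX i)) j) + (yexp s l - yexp (var_exp (VX i)) l)"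
        using edge[OF jl] True jl by (cases "j = i") (auto simp: lookup_var_exp)
    qed (use True i in \<open>auto simp: vertices\<close>)
  next
    case False
    then have A: "xexp s i = 0 \<or> (\<exists>j\<in>F. (p i, p j) \<in> r \<and> xexp s i + yexp s j \<le> snd s)"
      by (auto simp: not_less)
    have B: "snd s < xexp s l + yexp s i" if l: "l \<in> F" "(p l, p i) \<in> r" for l
      using A
    proof
      assume "\<exists>j\<in>F. (p i, p j) \<in> r \<and> xexp s i + yexp s j \<le> snd s"
      then obtain j where j: "j \<in> F" "(p i, p j) \<in> r" "xexp s i + yexp s j \<le> snd s"
        by blast
      have "snd s \<le> xexp s l + yexp s j"
        using edge[of l j] transitive[OF l(1) i(1) j(1) l(2) j(2)] l j by blast
      then show ?thesis
        using j(3) i(2) by linarith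
    qed (use i(2) in simp)
    have "yexp s i \<noteq> 0"
    proof
      assume 0: "yexp s i = 0"
      then show False
        using A i(2) by auto
    qed
    show thesis
    proof (rule lower[of "VY i"])
      fix j l assume jl: "j \<in> F" "l \<in> F" "(p j, p l) \<in> r"
      show "snd s \<le> (xexp s j - xexp (var_exp (VY i)) j) + (yexp s l - yexp (var_exp (VY i)) l)"
        using edge[OF jl] B[of j] jl by (cases "l = i") (auto simp: lookup_var_exp)
    qed (use \<open>yexp s i \<noteq> 0\<close> i in \<open>auto simp: vertices\<close>)
  qed
qed

text \<open>Variables are not tight, and the monomials that are not tight span an ideal. Conversely
  each of these is a variable times the monomial of another cover, by
  \<open>covers_not_tight_decompose\<close>.\<close>

lemma irrelevant_extension_eq:
  "irrelevant_extension G = (supported (covers - tight F) :: 'k::field mpoly poly set)"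
proof -
  interpret P: primeideal "supported (covers - tight F)" "monoid_algebra covers :: 'k mpoly poly ring"
    by (rule face_primeideal[OF face_W])
  let ?vars = "{[:var v:] | v. v \<in> fst G} :: 'k mpoly poly set"
  have vars: "?vars = monomial ` var_exp ` fst G"
    by (auto simp: var_eq_monomial var_exp_def)
  have "var_exp v \<in> covers - tight F" if "v \<in> fst G" for v
    using that var_exp_covers[OF that] by (auto simp: tight_def vertices lookup_var_exp)
  then have "?vars \<subseteq> supported (covers - tight F)"
    unfolding vars by (auto simp: monomial_supported)
  then have "irrelevant_extension G \<subseteq> (supported (covers - tight F) :: 'k mpoly poly set)"
    unfolding irrelevant_extension_def genideal_def vertex_cover_algebra_eq using P.is_ideal by blast
  moreover have "f \<in> J" if J: "ideal J (monoid_algebra covers)" "?vars \<subseteq> J"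
    and f: "f \<in> supported (covers - tight F)" for J and f :: "'k mpoly poly"
  proof -
    interpret J: ideal J "monoid_algebra covers :: 'k mpoly poly ring" by fact
    have mon: "scalar a * monomial s \<in> J" if s: "s \<in> covers - tight F" for s a
    proof -
      obtain v t where v: "v \<in> fst G" "t \<in> covers" "s = var_exp v + t"
        using covers_not_tight_decompose[of s] s by blast
      have "monomial (var_exp v) \<in> J"
        using J(2) v(1) unfolding vars by blast
      moreover have "scalar a * monomial t \<in> carrier (monoid_algebra covers)"
        using v(2) by (simp add: supported_closed monomial_supported)
      ultimately have "monomial (var_exp v) \<otimes>\<^bsub>monoid_algebra covers\<^esub> (scalar a * monomial t) \<in> J"
        by (rule J.I_r_closed)
      then show ?thesis
        by (simp add: v(3) monomial_add mult.left_commute)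
    qed
    have sum: "(\<Sum>s\<in>A. scalar (mcoeff f s) * monomial s) \<in> J" if "finite A" "A \<subseteq> covers - tight F" for A
      using that
    proof (induction A rule: finite_induct)
      case empty
      then show ?case using J.zero_closed by simp
    next
      case (insert s A)
      then show ?case
        using J.a_closed[OF mon[of s "mcoeff f s"]] by simp
    qed
    have "{s. mcoeff f s \<noteq> 0} \<subseteq> covers - tight F"
      using supportedD[OF f] by blast
    then have "(\<Sum>s\<in>{s. mcoeff f s \<noteq> 0}. scalar (mcoeff f s) * monomial s) \<in> J"
      by (rule sum[OF finite_mcoeff])
    then show "f \<in> J"
      using mcoeff_expand[OF finite_mcoeff order_refl, of f] by simp
  qed
  then have "(supported (covers - tight F) :: 'k mpoly poly set) \<subseteq> irrelevant_extension G"
    unfolding irrelevant_extension_def genideal_def vertex_cover_algebra_eq by blast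
  ultimately show ?thesis by blast
qed

lemma basic_cover_algebra_eq: "basic_cover_algebra G = (quotient :: 'k::field mpoly poly set ring)"
  by (simp add: basic_cover_algebra_def vertex_cover_algebra_eq irrelevant_extension_eq)

lemma residue_class_eq: "residue_class G = (quotient_map :: 'k::field mpoly poly \<Rightarrow> _)"
  by (intro ext) (simp add: residue_class_def quotient_map_def vertex_cover_algebra_eq irrelevant_extension_eq)

lemma deg_tight: "s \<in> tight F \<Longrightarrow> deg s = snd s"
  by (simp add: deg_def tight_def)

text \<open>The residues of the tight monomials form a basis, and on tight covers the degree is the
  order.\<close>

lemma hilbert_basic_eq:
  assumes "F \<noteq> {}"
  shows "hilbert_basic TYPE('k::field) p r F = Abs_fps (\<lambda>d. of_nat (card {s \<in> tight F. snd s = d}))"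
proof -
  let ?K = "quotient_map ` (scalars :: 'k mpoly poly set)"
  have "ring.dim quotient ?K (quotient_map ` (cover_algebra_component G d :: 'k mpoly poly set)) =
      card {s \<in> tight F. snd s = d}" for d
  proof -
    interpret Q: ring "quotient :: 'k mpoly poly set ring"
      by (rule ideal.quotient_is_ring[OF primeideal.axioms(1)[OF face_primeideal[OF face_W]]])
    have "{s \<in> covers. deg s = d} \<inter> tight F = {s \<in> tight F. snd s = d}"
      using deg_tight by (auto simp: tight_def)
    then have "quotient_map ` (cover_algebra_component G d :: 'k mpoly poly set) =
        quotient_map ` supported {s \<in> tight F. snd s = d}"
      unfolding cover_algebra_component_eq using quotient_map_supported[of "{s \<in> covers. deg s = d}"] by auto
    moreover have "finite {s \<in> tight F. snd s = d}"
      by (rule finite_subset[OF _ finite_deg[of d]]) (use deg_tight in \<open>auto simp: tight_def\<close>)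
    then have "Q.dimension (card {s \<in> tight F. snd s = d}) ?K (quotient_map ` supported {s \<in> tight F. snd s = d})"
      by (rule dimension_quotient) auto
    ultimately show ?thesis
      using Q.dimI[OF subfield_quotient] by (simp add: over_def)
  qed
  then show ?thesis
    using assms by (simp add: hilbert_basic_def hilbert_series_def Let_def residue_class_eq basic_cover_algebra_eq)
qed

section \<open>A flag of faces and the Krull dimensions\<close>

definition lower_part :: "nat \<Rightarrow> nat set" where
  "lower_part q = set (take q (sorted_list_of_set F))"

lemma lower_part_subset: "lower_part q \<subseteq> F"
  using set_take_subset[of q "sorted_list_of_set F"] by (simp add: lower_part_def)

lemma lower_part_all: "card F \<le> q \<Longrightarrow> lower_part q = F"
  by (simp add: lower_part_def)

lemma lower_part_0: "lower_part 0 = {}"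
  by (simp add: lower_part_def)

lemma lower_part_Suc:
  assumes "q < card F"
  obtains x where "x \<in> F" "x \<notin> lower_part q" "lower_part (Suc q) = insert x (lower_part q)"
proof -
  let ?xs = "sorted_list_of_set F"
  have q: "q < length ?xs" using assms by simp
  have "?xs ! q \<notin> set (take q ?xs)"
    using q by (auto simp: in_set_conv_nth nth_eq_iff_index_eq)
  then show ?thesis
    using q nth_mem[OF q] by (intro that[of "?xs ! q"]) (auto simp: lower_part_def take_Suc_conv_app_nth)
qed

text \<open>The labelling is a linear extension, so an initial segment of the sorted indices
  contains everything below its members.\<close>

lemma downset_lower_part: "downset (lower_part q)"
proof -
  let ?xs = "sorted_list_of_set F"
  have "i \<in> lower_part q" if ij: "i \<in> F" "j \<in> lower_part q" "i \<le> j" for i j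
  proof -
    obtain b where b: "b < q" "b < length ?xs" "?xs ! b = j"
      using ij(2) by (auto simp: lower_part_def in_set_conv_nth)
    have "i \<in> set ?xs" using ij(1) by simp
    then obtain a where a: "a < length ?xs" "?xs ! a = i"
      unfolding in_set_conv_nth by blast
    have "a \<le> b"
    proof (rule ccontr)
      assume "\<not> a \<le> b"
      then have "?xs ! b < ?xs ! a"
        using sorted_wrt_nth_less[OF strict_sorted_list_of_set[of F], of b a] a(1) by simp
      then show False
        using a b ij(3) by simp
    qed
    then show ?thesis
      using a b by (auto simp: lower_part_def in_set_conv_nth intro!: exI[of _ a])
  qed
  then show ?thesis
    unfolding downset_def using lower_part_subset label by blast
qed

text \<open>A maximal flag of faces; on the tight covers the \<open>x\<close>-exponents are killed from the top of the linear
  extension, so that the initial segments remain as witnesses for strictness.\<close>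

definition flag :: "nat \<Rightarrow> mon set" where
  "flag j = (if j < card F then tight (lower_part j)
     else if j \<le> 2 * card F then tight_zero (F - lower_part (2 * card F - j)) else {0})"

lemma flag_card: "flag (card F) = tight F"
  by (auto simp: flag_def tight_zero_def lower_part_all)

lemma face_flag: "face (flag j)"
  using face_tight[OF lower_part_subset] face_tight_zero face_zero by (simp add: flag_def)

lemma downset_exp_tight: "downset I \<Longrightarrow> downset_exp I \<in> tight F"
  using downset_exp_covers[of I] downset_exp_simps[of I] by (auto simp: tight_def downset_def)

text \<open>The witnesses are, in turn: the variable \<open>VX x\<close>, which is not tight at the
  newly added index; the cover of the initial segment ending at \<open>x\<close>, whose
  \<open>x\<close>-exponent there is 1; and the cover of the empty downset, which has order 1 and so
  differs from \<open>0\<close>.\<close>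

lemma flag_strict:
  assumes "j < 2 * card F + 1"
  shows "flag (Suc j) \<subset> flag j"
proof -
  consider "j < card F" | "card F \<le> j" "j < 2 * card F" | "j = 2 * card F"
    using assms by linarith
  then show ?thesis
  proof cases
    case 1
    then obtain x where x: "x \<in> F" "x \<notin> lower_part j" "lower_part (Suc j) = insert x (lower_part j)"
      by (rule lower_part_Suc)
    have "flag (Suc j) = tight (lower_part (Suc j))"
    proof (cases "Suc j = card F")
      case True
      then show ?thesis
        using flag_card lower_part_all[of "Suc j"] by simp
    qed (use 1 in \<open>simp add: flag_def\<close>)
    moreover have "flag j = tight (lower_part j)"
      using 1 by (simp add: flag_def)
    moreover have "tight (lower_part (Suc j)) \<subseteq> tight (lower_part j)"
      unfolding x(3) by (auto simp: tight_def)
    moreover have "var_exp (VX x) \<in> tight (lower_part j) - tight (lower_part (Suc j))"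
      using x var_exp_covers[of "VX x"] by (auto simp: tight_def lookup_var_exp vertices)
    ultimately show ?thesis by blast
  next
    case 2
    define q where "q = 2 * card F - Suc j"
    have q: "q < card F" "2 * card F - j = Suc q"
      using 2 by (auto simp: q_def)
    obtain x where x: "x \<in> F" "x \<notin> lower_part q" "lower_part (Suc q) = insert x (lower_part q)"
      using lower_part_Suc[OF q(1)] .
    have eq: "flag (Suc j) = tight_zero (F - lower_part q)" "flag j = tight_zero (F - lower_part (Suc q))"
      using 2 q(2) by (simp_all add: flag_def q_def)
    have "tight_zero (F - lower_part q) \<subseteq> tight_zero (F - lower_part (Suc q))"
      unfolding x(3) by (auto simp: tight_zero_def)
    moreover have "downset_exp (lower_part (Suc q)) \<in> tight_zero (F - lower_part (Suc q)) - tight_zero (F - lower_part q)"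
      using downset_exp_tight[OF downset_lower_part, of "Suc q"]
        downset_exp_simps(1)[OF lower_part_subset, of _ "Suc q"] x(1,2)
      by (auto simp: tight_zero_def x(3))
    ultimately show ?thesis
      unfolding eq by blast
  next
    case 3
    have eq: "flag (Suc j) = {0}" "flag j = tight_zero F"
      using 3 lower_part_all[of 0] by (auto simp: flag_def lower_part_0)
    have "0 \<in> tight_zero F"
      using face_tight_zero[of F] by (simp add: face_def)
    moreover have "downset_exp {} \<in> tight_zero F"
      using downset_exp_tight[of "{}"] downset_exp_simps[of "{}"] by (auto simp: tight_zero_def downset_def)
    moreover have "downset_exp {} \<noteq> 0"
      by (simp add: prod_eq_iff)
    ultimately show ?thesis
      unfolding eq by blast
  qed
qed

text \<open>Bounding each exponent separately, instead of \<open>deg\<close>, reduces the growth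
  estimate to counting points in a box.\<close>

definition filtration :: "nat \<Rightarrow> mon set" where
  "filtration N = {s \<in> covers. snd s \<le> N \<and> (\<forall>v. Poly_Mapping.lookup (fst s) v \<le> N)}"

lemma filtration_mono: "mono filtration"
  by (rule monoI) (auto simp: filtration_def intro: order_trans)

lemma filtration_add: "s \<in> filtration i \<Longrightarrow> t \<in> filtration j \<Longrightarrow> s + t \<in> filtration (i + j)"
  using add_mem by (auto simp: filtration_def lookup_add intro: add_mono)

lemma filtration_0: "0 \<in> filtration 0"
  using zero_mem by (simp add: filtration_def)

lemma filtration_exhaust: "(\<Union>i. filtration i) = covers"
proof (intro equalityI subsetI)
  fix s assume s: "s \<in> covers"
  define N where "N = snd s + (\<Sum>v\<in>fst G. Poly_Mapping.lookup (fst s) v)"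
  have "Poly_Mapping.lookup (fst s) v \<le> N" for v
  proof (cases "v \<in> fst G")
    case True
    then have "Poly_Mapping.lookup (fst s) v \<le> (\<Sum>v\<in>fst G. Poly_Mapping.lookup (fst s) v)"
      by (intro member_le_sum) (auto simp: vertices)
    then show ?thesis by (simp add: N_def)
  qed (simp add: lookup_eq_0[OF s])
  then have "s \<in> filtration N"
    using s by (simp add: filtration_def N_def)
  then show "s \<in> (\<Union>i. filtration i)" by blast
qed (auto simp: filtration_def)

lemma krull_dim_A: "krull_dim (vertex_cover_algebra G :: 'k::field mpoly poly ring) = enat (2 * card F + 1)"
  unfolding vertex_cover_algebra_eq
proof (rule krull_dim_monoid_algebra[where T = filtration and Z = flag])
  show "finite (filtration i)" "card (filtration i) \<le> (i + 1) ^ (2 * card F + 1)" for i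
    unfolding filtration_def by (rule bounded_covers)+
qed (rule filtration_mono filtration_exhaust filtration_0 filtration_add face_flag flag_strict; assumption?)+

text \<open>The order and the \<open>x\<close>-exponents determine a tight cover, so only
  \<open>card F + 1\<close> numbers are free.\<close>

lemma card_tight_filtration: "card (filtration N \<inter> tight F) \<le> (N + 1) ^ (card F + 1)"
proof -
  let ?f = "\<lambda>s. (restrict (xexp s) F, snd s)"
  have "inj_on ?f (filtration N \<inter> tight F)"
  proof (rule inj_onI)
    fix s t
    assume st: "s \<in> filtration N \<inter> tight F" "t \<in> filtration N \<inter> tight F" and eq: "?f s = ?f t"
    have x: "xexp s i = xexp t i" if "i \<in> F" for i
    proof -
      have "restrict (xexp s) F i = restrict (xexp t) F i"
        using eq by (metis prod.inject)
      then show ?thesis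
        using that by simp
    qed
    have k: "snd s = snd t"
      using eq by simp
    have "yexp s i = yexp t i" if "i \<in> F" for i
    proof -
      have "xexp s i + yexp s i = snd s" "xexp t i + yexp t i = snd t"
        using st that by (auto simp: tight_def)
      then show ?thesis
        using x[OF that] k by linarith
    qed
    then show "s = t"
      using st x k by (intro covers_eqI) (auto simp: tight_def)
  qed
  moreover have "?f ` (filtration N \<inter> tight F) \<subseteq> (F \<rightarrow>\<^sub>E {..N}) \<times> {..N}"
    by (auto simp: filtration_def)
  moreover have "finite ((F \<rightarrow>\<^sub>E {..N}) \<times> {..N})"
    by (intro finite_cartesian_product finite_PiE) auto
  ultimately have "card (filtration N \<inter> tight F) \<le> card ((F \<rightarrow>\<^sub>E {..N}) \<times> {..N})"
    by (rule card_inj_on_le)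
  then show ?thesis
    by (simp add: card_cartesian_product card_PiE algebra_simps)
qed

text \<open>The flag passes through \<open>tight F\<close> at index \<open>card F\<close>; its
  remaining \<open>card F + 1\<close> steps give the chain of primes.\<close>

lemma krull_dim_basic: "krull_dim (basic_cover_algebra G :: 'k::field mpoly poly set ring) = enat (card F + 1)"
  unfolding basic_cover_algebra_eq
proof (rule krull_dim_quotient[where T = "\<lambda>i. filtration i \<inter> tight F" and Z = "\<lambda>i. flag (card F + i)"])
  show "finite (filtration i \<inter> tight F)" for i
    unfolding filtration_def using bounded_covers(1) by blast
  show "card (filtration i \<inter> tight F) \<le> (i + 1) ^ (card F + 1)" for i
    by (rule card_tight_filtration)
  show "mono (\<lambda>i. filtration i \<inter> tight F)"
    using filtration_mono by (auto simp: mono_def)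
  show "(\<Union>i. filtration i \<inter> tight F) = tight F"
    using filtration_exhaust by (auto simp: tight_def)
  show "0 \<in> filtration 0 \<inter> tight F"
    using filtration_0 face_W by (simp add: face_def)
  show "s + t \<in> filtration (i + j) \<inter> tight F"
    if "s \<in> filtration i \<inter> tight F" "t \<in> filtration j \<inter> tight F" for i j s t
    using that filtration_add face_W by (auto simp: face_def tight_def)
  show "flag (card F + Suc i) \<subset> flag (card F + i)" if "i < card F + 1" for i
    using flag_strict[of "card F + i"] that by simp
qed (simp_all add: face_flag flag_card)

end

section \<open>Generating functions\<close>

definition genfun :: "'b set \<Rightarrow> ('b \<Rightarrow> nat) \<Rightarrow> rat fps" where
  "genfun A w = Abs_fps (\<lambda>d. of_nat (card {x \<in> A. w x = d}))"

text \<open>Since \<open>card\<close> of an infinite set is \<open>0\<close>, finiteness of the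
  fibers has to accompany every use of \<open>genfun\<close> as a counting series.\<close>

definition finite_fibers :: "'b set \<Rightarrow> ('b \<Rightarrow> nat) \<Rightarrow> bool" where
  "finite_fibers A w \<longleftrightarrow> (\<forall>d. finite {x \<in> A. w x = d})"

lemma genfun_bij_betw:
  assumes f: "bij_betw f A B" and w: "\<And>x. x \<in> A \<Longrightarrow> v (f x) = w x"
  shows "genfun A w = genfun B v"
proof -
  have "bij_betw f {x \<in> A. w x = d} {y \<in> B. v y = d}" for d
  proof (rule bij_betw_imageI)
    show "inj_on f {x \<in> A. w x = d}"
      using f by (auto simp: bij_betw_def inj_on_def)
    show "f ` {x \<in> A. w x = d} = {y \<in> B. v y = d}"
      using f w by (auto simp: bij_betw_def)
  qed
  then show ?thesis
    unfolding genfun_def by (intro arg_cong[of _ _ Abs_fps] ext arg_cong[of _ _ of_nat] bij_betw_same_card)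
qed

lemma fiber_Times:
  fixes w :: "'b \<Rightarrow> nat" and v :: "'c \<Rightarrow> nat"
  shows "{z \<in> A \<times> B. w (fst z) + v (snd z) = d} = (\<Union>i\<le>d. {x \<in> A. w x = i} \<times> {y \<in> B. v y = d - i})"
  by auto

lemma finite_fibers_Times:
  assumes "finite_fibers A w" "finite_fibers B v"
  shows "finite_fibers (A \<times> B) (\<lambda>z. w (fst z) + v (snd z))"
  using assms unfolding finite_fibers_def fiber_Times by blast

lemma genfun_Times:
  assumes "finite_fibers A w" "finite_fibers B v"
  shows "genfun (A \<times> B) (\<lambda>z. w (fst z) + v (snd z)) = genfun A w * genfun B v"
proof (rule fps_ext)
  fix d
  have "card {z \<in> A \<times> B. w (fst z) + v (snd z) = d} =
      (\<Sum>i\<le>d. card ({x \<in> A. w x = i} \<times> {y \<in> B. v y = d - i}))"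
    unfolding fiber_Times using assms by (intro card_UN_disjoint) (auto simp: finite_fibers_def)
  then show "fps_nth (genfun (A \<times> B) (\<lambda>z. w (fst z) + v (snd z))) d = fps_nth (genfun A w * genfun B v) d"
    by (simp add: genfun_def fps_mult_nth card_cartesian_product atMost_atLeast0)
qed

lemma genfun_partition:
  assumes "finite_fibers A w" "finite I" "f ` A \<subseteq> I"
  shows "genfun A w = (\<Sum>i\<in>I. genfun {x \<in> A. f x = i} w)"
proof (rule fps_ext)
  fix d
  have "{x \<in> A. w x = d} = (\<Union>i\<in>I. {x \<in> {x \<in> A. f x = i}. w x = d})"
    using assms(3) by auto
  also have "card \<dots> = (\<Sum>i\<in>I. card {x \<in> {x \<in> A. f x = i}. w x = d})"
  proof (intro card_UN_disjoint assms(2) ballI)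
    show "finite {x \<in> {x \<in> A. f x = i}. w x = d}" for i
      using assms(1) unfolding finite_fibers_def by (elim allE[of _ d] rev_finite_subset) auto
  qed auto
  finally show "fps_nth (genfun A w) d = fps_nth (\<Sum>i\<in>I. genfun {x \<in> A. f x = i} w) d"
    by (simp add: genfun_def fps_sum_nth)
qed

text \<open>The values at different indices are independent and the weights add up, so the series
  multiply. Both claims are proved together because the product rule for one more index uses the
  finite fibers of the previous ones.\<close>

lemma genfun_functions:
  assumes "finite I" "finite_fibers B id"
  shows "finite_fibers (I \<rightarrow>\<^sub>E B) (\<lambda>f. \<Sum>i\<in>I. f i) \<and>
    genfun (I \<rightarrow>\<^sub>E B) (\<lambda>f. \<Sum>i\<in>I. f i) = genfun B id ^ card I"
  using assms(1)
proof (induction I rule: finite_induct)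
  case empty
  have "{x. x = (\<lambda>_. undefined) \<and> 0 = d} = (if d = 0 then {\<lambda>_. undefined :: nat} else {})" for d :: nat
    by auto
  then show ?case
    by (auto simp: finite_fibers_def genfun_def fps_eq_iff)
next
  case (insert i I)
  let ?f = "\<lambda>z. (snd z)(i := fst z)"
  let ?w = "\<lambda>f. \<Sum>i\<in>I. f i" and ?w' = "\<lambda>f. \<Sum>i\<in>insert i I. f i"
  let ?v = "\<lambda>z. id (fst z) + ?w (snd z)"
  have eq: "(insert i I \<rightarrow>\<^sub>E B) = ?f ` (B \<times> (I \<rightarrow>\<^sub>E B))"
    unfolding PiE_insert_eq by (rule image_cong) auto
  have inj: "inj_on ?f (B \<times> (I \<rightarrow>\<^sub>E B))"
  proof (rule inj_onI)
    fix x y assume xy: "x \<in> B \<times> (I \<rightarrow>\<^sub>E B)" "y \<in> B \<times> (I \<rightarrow>\<^sub>E B)" and eq: "?f x = ?f y"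
    \<comment> \<open>Both functions are \<open>undefined\<close> at \<open>i\<close>, which is not
      in \<open>I\<close>; so overwriting the value there loses no information.\<close>
    have "snd x i = snd y i"
      using xy insert.hyps(2) by (auto simp: PiE_def extensional_def)
    then have "snd x j = snd y j" for j
      using fun_cong[OF eq, of j] by (cases "j = i") auto
    moreover have "fst x = fst y"
      using fun_cong[OF eq, of i] by simp
    ultimately show "x = y"
      by (simp add: prod_eq_iff fun_eq_iff)
  qed
  have bij: "bij_betw ?f (B \<times> (I \<rightarrow>\<^sub>E B)) (insert i I \<rightarrow>\<^sub>E B)"
    unfolding eq using inj by (rule inj_on_imp_bij_betw)
  have w: "?w' (?f z) = ?v z" for z
  proof -
    have "(\<Sum>j\<in>I. ?f z j) = ?w (snd z)"
      using insert.hyps by (intro sum.cong) auto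
    then show ?thesis
      using insert.hyps by simp
  qed
  have fin: "finite_fibers (B \<times> (I \<rightarrow>\<^sub>E B)) ?v"
    using finite_fibers_Times[OF assms(2) conjunct1[OF insert.IH]] .
  have "{f \<in> insert i I \<rightarrow>\<^sub>E B. ?w' f = d} \<subseteq> ?f ` {z \<in> B \<times> (I \<rightarrow>\<^sub>E B). ?v z = d}" for d
  proof
    fix f assume f: "f \<in> {f \<in> insert i I \<rightarrow>\<^sub>E B. ?w' f = d}"
    then obtain z where z: "z \<in> B \<times> (I \<rightarrow>\<^sub>E B)" "f = ?f z"
      unfolding eq by blast
    moreover have "?v z = d"
      using f w[of z] z(2) by simp
    ultimately show "f \<in> ?f ` {z \<in> B \<times> (I \<rightarrow>\<^sub>E B). ?v z = d}"
      by blast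
  qed
  then have "finite_fibers (insert i I \<rightarrow>\<^sub>E B) ?w'"
    using fin unfolding finite_fibers_def by (meson finite_imageI finite_subset)
  moreover have "genfun (insert i I \<rightarrow>\<^sub>E B) ?w' = genfun (B \<times> (I \<rightarrow>\<^sub>E B)) ?v"
    by (rule genfun_bij_betw[where v = ?w' and w = ?v, OF bij w, symmetric])
  moreover have "\<dots> = genfun B id * genfun (I \<rightarrow>\<^sub>E B) ?w"
    by (rule genfun_Times[OF assms(2) conjunct1[OF insert.IH]])
  ultimately show ?case
    using insert by (simp add: id_def)
qed

lemma finite_fibers_nat: "finite_fibers (B :: nat set) id"
  by (simp add: finite_fibers_def)

lemma fps_one_minus_X_nonzero: "1 - fps_X \<noteq> (0 :: rat fps)"
  by (metis diff_eq_diff_eq diff_zero fps_X_neq_one diff_self)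

lemma genfun_UNIV: "genfun UNIV id = 1 / (1 - fps_X)"
proof -
  have "{x. x = d} = {d}" for d :: nat by auto
  then have "genfun UNIV id * (1 - fps_X) = 1"
    by (auto simp: genfun_def fps_eq_iff algebra_simps)
  then show ?thesis
    using fps_one_minus_X_nonzero by (metis nonzero_mult_div_cancel_right)
qed

lemma genfun_positive: "genfun {1..} id = fps_X / (1 - fps_X)"
proof -
  have "{x. Suc 0 \<le> x \<and> x = d} = (if d = 0 then {} else {d})" for d :: nat by auto
  then have "genfun {1..} id = fps_X * genfun UNIV id"
    by (auto simp: genfun_def fps_eq_iff)
  also have "\<dots> * (1 - fps_X) = fps_X"
    using fps_one_minus_X_nonzero by (simp add: genfun_UNIV mult.assoc fps_divide_times_eq)
  finally show ?thesis
    using fps_one_minus_X_nonzero by (metis nonzero_mult_div_cancel_right)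
qed

section \<open>Order-reversing maps\<close>

definition order_maps :: "(nat \<Rightarrow> 'a) \<Rightarrow> 'a rel \<Rightarrow> nat set \<Rightarrow> nat \<Rightarrow> (nat \<Rightarrow> nat) set" where
  "order_maps p r D k = {u \<in> D \<rightarrow>\<^sub>E {..k}. \<forall>i\<in>D. \<forall>j\<in>D. (p i, p j) \<in> r \<longrightarrow> u j \<le> u i}"

definition order_series :: "(nat \<Rightarrow> 'a) \<Rightarrow> 'a rel \<Rightarrow> nat set \<Rightarrow> rat fps" where
  "order_series p r D = Abs_fps (\<lambda>k. of_nat (card (order_maps p r D k)))"

text \<open>The same notion as \<open>downset\<close>, with the ground set as a parameter since the
  recursion below passes to smaller posets.\<close>

definition lower_sets :: "(nat \<Rightarrow> 'a) \<Rightarrow> 'a rel \<Rightarrow> nat set \<Rightarrow> nat set set" where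
  "lower_sets p r D = {I. I \<subseteq> D \<and> (\<forall>i\<in>D. \<forall>j\<in>I. (p i, p j) \<in> r \<longrightarrow> i \<in> I)}"

lemma finite_order_maps: "finite D \<Longrightarrow> finite (order_maps p r D k)"
  unfolding order_maps_def by (rule finite_subset[of _ "D \<rightarrow>\<^sub>E {..k}"]) (auto intro: finite_PiE)

lemma finite_lower_sets: "finite D \<Longrightarrow> finite (lower_sets p r D)"
  unfolding lower_sets_def by (rule finite_subset[of _ "Pow D"]) auto

lemma card_order_maps_0: "card (order_maps p r D 0) = 1"
proof -
  have "order_maps p r D 0 = {restrict (\<lambda>_. 0) D}"
    by (auto simp: order_maps_def PiE_iff extensional_def fun_eq_iff)
  then show ?thesis by simp
qed

text \<open>Subtracting 1 on the support \<open>I\<close> is a bijection. Its inverse adds 1 on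
  \<open>I\<close> and extends by zero, which is order-reversing because \<open>I\<close> is a lower
  set.\<close>

lemma card_order_maps_support:
  assumes I: "I \<in> lower_sets p r D"
  shows "card {u \<in> order_maps p r D (Suc k). {i \<in> D. u i \<noteq> 0} = I} = card (order_maps p r I k)"
proof -
  let ?A = "{u \<in> order_maps p r D (Suc k). {i \<in> D. u i \<noteq> 0} = I}" and ?B = "order_maps p r I k"
  let ?f = "\<lambda>u. restrict (\<lambda>i. u i - 1) I" and ?g = "\<lambda>v. restrict (\<lambda>i. if i \<in> I then v i + 1 else 0) D"
  have ID: "I \<subseteq> D"
    using I by (simp add: lower_sets_def)
  have low: "i \<in> I" if "i \<in> D" "j \<in> I" "(p i, p j) \<in> r" for i j
    using I that unfolding lower_sets_def by blast
  have "\<forall>u\<in>?A. ?g (?f u) = u"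
  proof
    fix u assume u: "u \<in> ?A"
    show "?g (?f u) = u"
    proof
      fix i
      show "?g (?f u) i = u i"
        using u ID by (cases "i \<in> D") (auto simp: order_maps_def PiE_iff extensional_def)
    qed
  qed
  moreover have "\<forall>v\<in>?B. ?f (?g v) = v"
  proof
    fix v assume v: "v \<in> ?B"
    show "?f (?g v) = v"
    proof
      fix i
      show "?f (?g v) i = v i"
        using v ID by (cases "i \<in> I") (auto simp: order_maps_def PiE_iff extensional_def)
    qed
  qed
  moreover have "?f ` ?A \<subseteq> ?B"
  proof
    fix v assume "v \<in> ?f ` ?A"
    then obtain u where u: "u \<in> ?A" "v = ?f u" by blast
    have "u i - 1 \<le> k" if "i \<in> I" for i
    proof -
      have "u i \<le> Suc k"
        using u(1) that ID by (auto simp: order_maps_def PiE_iff)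
      then show ?thesis by simp
    qed
    moreover have "u j \<le> u i" if "i \<in> I" "j \<in> I" "(p i, p j) \<in> r" for i j
      using u(1) that ID unfolding order_maps_def by blast
    ultimately show "v \<in> ?B"
      unfolding u(2) order_maps_def by (auto simp: PiE_iff intro!: diff_le_mono)
  qed
  moreover have "?g ` ?B \<subseteq> ?A"
  proof
    fix u assume "u \<in> ?g ` ?B"
    then obtain v where v: "v \<in> ?B" "u = ?g v" by blast
    have "u j \<le> u i" if ij: "i \<in> D" "j \<in> D" "(p i, p j) \<in> r" for i j
    proof (cases "j \<in> I")
      case True
      then have "i \<in> I"
        using low[of i j] ij by blast
      then have "v j \<le> v i"
        using v(1) True ij(3) unfolding order_maps_def by blast
      then show ?thesis
        using \<open>i \<in> I\<close> True ij by (simp add: v(2))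
    qed (use ij in \<open>simp add: v(2)\<close>)
    moreover have "u \<in> D \<rightarrow>\<^sub>E {..Suc k}"
      using v(1) by (auto simp: v(2) order_maps_def PiE_iff)
    ultimately have "u \<in> order_maps p r D (Suc k)"
      unfolding order_maps_def by blast
    moreover have "{i \<in> D. u i \<noteq> 0} = I"
      using ID unfolding v(2) by auto
    ultimately show "u \<in> ?A" by blast
  qed
  ultimately have "bij_betw ?f ?A ?B"
    by (rule bij_betw_byWitness)
  then show ?thesis
    by (rule bij_betw_same_card)
qed

text \<open>The support of an order-reversing map is a lower set, and the maps are sorted by their
  support.\<close>

lemma card_order_maps_Suc:
  assumes "finite D"
  shows "card (order_maps p r D (Suc k)) = (\<Sum>I\<in>lower_sets p r D. card (order_maps p r I k))"
proof -
  have "{i \<in> D. u i \<noteq> 0} \<in> lower_sets p r D" if "u \<in> order_maps p r D (Suc k)" for u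
    using that unfolding order_maps_def lower_sets_def by fastforce
  then have "order_maps p r D (Suc k) =
      (\<Union>I\<in>lower_sets p r D. {u \<in> order_maps p r D (Suc k). {i \<in> D. u i \<noteq> 0} = I})"
    by blast
  also have "card \<dots> = (\<Sum>I\<in>lower_sets p r D. card {u \<in> order_maps p r D (Suc k). {i \<in> D. u i \<noteq> 0} = I})"
    using finite_order_maps[OF assms] finite_lower_sets[OF assms]
    by (intro card_UN_disjoint ballI) (auto intro: finite_subset)
  also have "\<dots> = (\<Sum>I\<in>lower_sets p r D. card (order_maps p r I k))"
    by (intro sum.cong refl card_order_maps_support)
  finally show ?thesis .
qed

text \<open>The summand 1 accounts for the only map into \<open>{0}\<close>, the factor
  \<open>fps_X\<close> for the drop of the bound by one.\<close>

lemma order_series_recursion: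
  assumes "finite D"
  shows "order_series p r D = 1 + fps_X * (\<Sum>I\<in>lower_sets p r D. order_series p r I)"
proof (rule fps_ext)
  fix k
  show "fps_nth (order_series p r D) k =
      fps_nth (1 + fps_X * (\<Sum>I\<in>lower_sets p r D. order_series p r I)) k"
    using card_order_maps_Suc[OF assms, of p r]
    by (cases k) (simp_all add: order_series_def card_order_maps_0 fps_sum_nth)
qed

lemma fps_of_poly_one_minus_X: "fps_of_poly [:1, -1:] = (1 - fps_X :: rat fps)"
  by (simp add: fps_of_poly_linear' flip: fps_const_neg)

lemma order_series_empty: "order_series p r {} * (1 - fps_X) = 1"
proof -
  have "order_maps p r {} k = {\<lambda>_. undefined}" for k
    by (auto simp: order_maps_def)
  then show ?thesis
    by (auto simp: order_series_def fps_eq_iff algebra_simps)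
qed

text \<open>In the recursion the lower set \<open>D\<close> itself contributes
  \<open>fps_X * order_series p r D\<close>; moving this to the left produces one factor
  \<open>1 - fps_X\<close>. The other lower sets are proper, so by induction a denominator of
  exponent \<open>card D\<close> suffices for them.\<close>

lemma order_series_rational:
  assumes "finite D"
  shows "\<exists>h. order_series p r D * (1 - fps_X) ^ (card D + 1) = fps_of_poly h"
  using assms
proof (induction D rule: finite_psubset_induct)
  case (psubset D)
  let ?L = "lower_sets p r D - {D}" and ?m = "card D"
  have D: "D \<in> lower_sets p r D"
    by (auto simp: lower_sets_def)
  have "\<exists>g. order_series p r I * (1 - fps_X) ^ ?m = fps_of_poly g" if "I \<in> ?L" for I
  proof -
    have sub: "I \<subset> D"
      using that by (auto simp: lower_sets_def)
    then obtain h where h: "order_series p r I * (1 - fps_X) ^ (card I + 1) = fps_of_poly h"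
      using psubset.IH by blast
    have "card I + 1 \<le> ?m"
      using psubset_card_mono[OF \<open>finite D\<close> sub] by simp
    then have "?m = (card I + 1) + (?m - (card I + 1))" by simp
    then have "order_series p r I * (1 - fps_X) ^ ?m = fps_of_poly h * (1 - fps_X) ^ (?m - (card I + 1))"
      by (metis h mult.assoc power_add)
    also have "\<dots> = fps_of_poly (h * [:1, -1:] ^ (?m - (card I + 1)))"
      by (simp add: fps_of_poly_mult fps_of_poly_power fps_of_poly_one_minus_X)
    finally show ?thesis by blast
  qed
  then obtain g where g: "\<And>I. I \<in> ?L \<Longrightarrow> order_series p r I * (1 - fps_X) ^ ?m = fps_of_poly (g I)"
    by metis
  have "order_series p r D = 1 + fps_X * (order_series p r D + (\<Sum>I\<in>?L. order_series p r I))"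
    using order_series_recursion[OF psubset.hyps, of p r] sum.remove[OF finite_lower_sets[OF psubset.hyps] D]
    by metis
  then have "order_series p r D * (1 - fps_X) = 1 + fps_X * (\<Sum>I\<in>?L. order_series p r I)"
    by (simp add: algebra_simps)
  then have "order_series p r D * (1 - fps_X) ^ (?m + 1) =
      (1 + fps_X * (\<Sum>I\<in>?L. order_series p r I)) * (1 - fps_X) ^ ?m"
    by (simp add: mult.assoc[symmetric])
  also have "\<dots> = (1 - fps_X) ^ ?m + fps_X * (\<Sum>I\<in>?L. order_series p r I * (1 - fps_X) ^ ?m)"
    by (simp add: distrib_right mult.assoc sum_distrib_right)
  also have "\<dots> = fps_of_poly ([:1, -1:] ^ ?m + [:0, 1:] * (\<Sum>I\<in>?L. g I))"
    by (simp add: g fps_of_poly_add fps_of_poly_mult fps_of_poly_power fps_of_poly_one_minus_X fps_of_poly_sum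
        fps_of_poly_pCons[of 0])
  finally show ?case by blast
qed

section \<open>The Hilbert series\<close>

context labelled_poset
begin

definition exps :: "(nat \<Rightarrow> nat) \<Rightarrow> (nat \<Rightarrow> nat) \<Rightarrow> vertex \<Rightarrow>\<^sub>0 nat" where
  "exps a b = (\<Sum>i\<in>F. Poly_Mapping.single (VX i) (a i)) + (\<Sum>i\<in>F. Poly_Mapping.single (VY i) (b i))"

lemma lookup_exps:
  "Poly_Mapping.lookup (exps a b) (VX i) = (if i \<in> F then a i else 0)"
  "Poly_Mapping.lookup (exps a b) (VY i) = (if i \<in> F then b i else 0)"
  by (simp_all add: exps_def lookup_add lookup_sum lookup_single when_def)

lemma exps_covers_iff:
  "(exps a b, k) \<in> covers \<longleftrightarrow> (\<forall>i\<in>F. \<forall>j\<in>F. (p i, p j) \<in> r \<longrightarrow> k \<le> a i + b j)"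
proof -
  have "v \<in> fst G" if "v \<in> Poly_Mapping.keys (exps a b)" for v
    using that by (cases v) (auto simp: in_keys_iff lookup_exps vertices split: if_splits)
  then show ?thesis
    by (auto simp: covers_iff lookup_exps)
qed

text \<open>For a tight cover of order \<open>d\<close> the \<open>y\<close>-exponents are
  \<open>d\<close> minus the \<open>x\<close>-exponents, and the condition on the edge
  \<open>{VX i, VY j}\<close> becomes \<open>xexp s j \<le> xexp s i\<close>.\<close>

lemma card_tight: "card {s \<in> tight F. snd s = d} = card (order_maps p r F d)"
proof (rule bij_betw_same_card)
  let ?f = "\<lambda>s. restrict (xexp s) F"
  show "bij_betw ?f {s \<in> tight F. snd s = d} (order_maps p r F d)"
  proof (rule bij_betw_imageI)
    show "inj_on ?f {s \<in> tight F. snd s = d}"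
    proof (rule inj_onI)
      fix s t
      assume st: "s \<in> {s \<in> tight F. snd s = d}" "t \<in> {s \<in> tight F. snd s = d}" and eq: "?f s = ?f t"
      have x: "xexp s i = xexp t i" if "i \<in> F" for i
        using fun_cong[OF eq, of i] that by simp
      have "yexp s i = yexp t i" if "i \<in> F" for i
      proof -
        have "xexp s i + yexp s i = d" "xexp t i + yexp t i = d"
          using st that by (auto simp: tight_def)
        then show ?thesis
          using x[OF that] by linarith
      qed
      then show "s = t"
        using st x by (intro covers_eqI) (auto simp: tight_def)
    qed
    show "?f ` {s \<in> tight F. snd s = d} = order_maps p r F d"
    proof (intro equalityI subsetI)
      fix u assume "u \<in> ?f ` {s \<in> tight F. snd s = d}"
      then obtain s where s: "s \<in> covers" "snd s = d" "u = ?f s" "\<And>i. i \<in> F \<Longrightarrow> xexp s i + yexp s i = d"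
        by (auto simp: tight_def)
      have "xexp s j \<le> xexp s i" if "i \<in> F" "j \<in> F" "(p i, p j) \<in> r" for i j
      proof -
        have "d \<le> xexp s i + yexp s j"
          using s(1,2) that by (auto simp: covers_iff)
        then show ?thesis
          using s(4)[OF that(2)] by linarith
      qed
      moreover have "xexp s i \<le> d" if "i \<in> F" for i
        using s(4)[OF that] by linarith
      ultimately show "u \<in> order_maps p r F d"
        by (simp add: s(3) order_maps_def PiE_iff)
    next
      fix u assume u: "u \<in> order_maps p r F d"
      have le: "u i \<le> d" if "i \<in> F" for i
        using u that by (auto simp: order_maps_def PiE_iff)
      have mono: "u j \<le> u i" if "i \<in> F" "j \<in> F" "(p i, p j) \<in> r" for i j
        using u that by (auto simp: order_maps_def)
      let ?s = "(exps u (\<lambda>i. d - u i), d)"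
      have "?s \<in> covers"
        unfolding exps_covers_iff
      proof (intro ballI impI)
        fix i j assume ij: "i \<in> F" "j \<in> F" "(p i, p j) \<in> r"
        show "d \<le> u i + (d - u j)"
          using mono[OF ij] le[OF ij(2)] by linarith
      qed
      then have "?s \<in> {s \<in> tight F. snd s = d}"
        using le by (simp add: tight_def lookup_exps)
      moreover have "?f ?s = u"
        using u by (auto simp: fun_eq_iff lookup_exps order_maps_def PiE_iff extensional_def)
      ultimately show "u \<in> ?f ` {s \<in> tight F. snd s = d}"
        using image_eqI[where f = ?f and x = ?s and b = u] by simp
    qed
  qed
qed

lemma hilbert_basic_order_series: "hilbert_basic TYPE('k::field) p r F = order_series p r F"
proof (cases "F = {}")
  case True
  \<comment> \<open>There is one map on the empty set for every bound, in accordance with the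
    convention for the empty subposet.\<close>
  have "order_series p r {} = 1 / (1 - fps_X)"
    using fps_one_minus_X_nonzero order_series_empty by (metis nonzero_mult_div_cancel_right)
  then show ?thesis
    using True by (simp add: hilbert_basic_def)
next
  case False
  then show ?thesis
    by (simp add: hilbert_basic_eq order_series_def card_tight)
qed

section \<open>The core of a cover\<close>

definition lowmin :: "nat set \<Rightarrow> (nat \<Rightarrow> nat) \<Rightarrow> nat \<Rightarrow> nat \<Rightarrow> nat" where
  "lowmin A u k i = Min (insert k (u ` {j \<in> A. (p j, p i) \<in> r}))"

lemma finite_lowmin: "A \<subseteq> F \<Longrightarrow> finite (u ` {j \<in> A. (p j, p i) \<in> r})"
  using finite_subset[of A F] by auto

lemma lowmin_le_k: "A \<subseteq> F \<Longrightarrow> lowmin A u k i \<le> k"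
  unfolding lowmin_def by (rule Min_le) (auto simp: finite_lowmin)

lemma lowmin_le: "A \<subseteq> F \<Longrightarrow> j \<in> A \<Longrightarrow> (p j, p i) \<in> r \<Longrightarrow> lowmin A u k i \<le> u j"
  unfolding lowmin_def by (rule Min_le) (auto simp: finite_lowmin)

text \<open>Inserting \<open>k\<close> caps the minimum by the order and keeps the set nonempty, so
  the minimum is attained either at the cap or at an index below \<open>i\<close>.\<close>

lemma lowmin_cases:
  assumes "A \<subseteq> F"
  obtains "lowmin A u k i = k" | j where "j \<in> A" "(p j, p i) \<in> r" "lowmin A u k i = u j"
proof -
  have "lowmin A u k i \<in> insert k (u ` {j \<in> A. (p j, p i) \<in> r})"
    unfolding lowmin_def using finite_lowmin[OF assms] by (intro Min_in) auto
  then show ?thesis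
    using that by auto
qed

lemma lowmin_cong: "(\<And>j. j \<in> A \<Longrightarrow> u j = v j) \<Longrightarrow> lowmin A u k i = lowmin A v k i"
  unfolding lowmin_def by (intro arg_cong[of _ _ Min] arg_cong2[of _ _ _ _ insert] image_cong) auto

lemma lowmin_antimono:
  assumes "A \<subseteq> F" "i \<in> F" "j \<in> F" "(p i, p j) \<in> r"
  shows "lowmin A u k j \<le> lowmin A u k i"
  using assms(1)
proof (cases rule: lowmin_cases[of A u k i])
  case (2 l)
  then have "(p l, p j) \<in> r"
    using transitive assms by blast
  then show ?thesis
    using lowmin_le[OF assms(1) 2(1)] 2(3) by simp
qed (simp add: lowmin_le_k assms(1))

text \<open>The largest order-reversing map below the \<open>x\<close>-exponents and the order of the cover; it is the
  \<open>x\<close>-part of a tight cover below \<open>s\<close>.\<close>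

definition core :: "mon \<Rightarrow> nat \<Rightarrow> nat" where
  "core s = lowmin F (xexp s) (snd s)"

definition core_set :: "mon \<Rightarrow> nat set" where
  "core_set s = {i \<in> F. xexp s i = core s i}"

lemma core_le: "i \<in> F \<Longrightarrow> core s i \<le> xexp s i" "core s i \<le> snd s"
  unfolding core_def by (rule lowmin_le[OF order_refl _ reflexive] lowmin_le_k[OF order_refl]; assumption)+

lemma core_antimono: "i \<in> F \<Longrightarrow> j \<in> F \<Longrightarrow> (p i, p j) \<in> r \<Longrightarrow> core s j \<le> core s i"
  unfolding core_def by (rule lowmin_antimono[OF order_refl])

text \<open>If the core value is the exponent of some \<open>j\<close> below \<open>i\<close>, this
  is the condition on the edge \<open>{VX j, VY i}\<close>; if it is the order, nothing is left to
  show.\<close>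

lemma core_yexp:
  assumes "s \<in> covers" "i \<in> F"
  shows "snd s \<le> core s i + yexp s i"
  using order_refl[of F]
proof (cases rule: lowmin_cases[of F "xexp s" "snd s" i])
  case (2 j)
  then show ?thesis
    using assms by (auto simp: covers_iff core_def)
qed (simp add: core_def)

text \<open>Suppose the minimum at \<open>i\<close> is attained at \<open>j\<close> below
  \<open>i\<close>. Since the core is order-reversing,
  \<open>xexp s j = core s i \<le> core s j\<close>, so \<open>j\<close> lies in the core set. Thus
  the core is determined by the order and the exponents on the core set.\<close>

lemma core_eq_lowmin_core_set:
  assumes "i \<in> F"
  shows "core s i = lowmin (core_set s) (xexp s) (snd s) i"
proof (rule antisym)
  have sub: "core_set s \<subseteq> F"
    by (auto simp: core_set_def)
  show "core s i \<le> lowmin (core_set s) (xexp s) (snd s) i"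
    using sub
  proof (cases rule: lowmin_cases[of "core_set s" "xexp s" "snd s" i])
    case (2 j)
    then show ?thesis
      using lowmin_le[OF order_refl, of j i "xexp s" "snd s"] sub by (auto simp: core_def)
  qed (simp add: core_le)
  show "lowmin (core_set s) (xexp s) (snd s) i \<le> core s i"
    using order_refl[of F]
  proof (cases rule: lowmin_cases[of F "xexp s" "snd s" i])
    case 1
    then show ?thesis
      using lowmin_le_k[OF sub] by (simp add: core_def)
  next
    case (2 j)
    then have "xexp s j = core s i"
      by (simp add: core_def)
    then have "xexp s j \<le> core s j"
      using core_antimono[OF 2(1) assms 2(2), of s] by simp
    then have "j \<in> core_set s"
      using core_le(1)[OF 2(1), of s] 2(1) by (simp add: core_set_def)
    then show ?thesis
      using lowmin_le[OF sub _ 2(2)] \<open>xexp s j = core s i\<close> by metis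
  qed
qed

section \<open>The bijection behind the Hilbert series\<close>

definition order_pairs :: "nat set \<Rightarrow> ((nat \<Rightarrow> nat) \<times> nat) set" where
  "order_pairs D = {z. fst z \<in> order_maps p r D (snd z)}"

definition encode :: "nat set \<Rightarrow> mon \<Rightarrow> ((nat \<Rightarrow> nat) \<times> nat) \<times> (nat \<Rightarrow> nat) \<times> (nat \<Rightarrow> nat)" where
  "encode D s = ((restrict (xexp s) D, snd s), restrict (\<lambda>i. yexp s i - (snd s - core s i)) F,
     restrict (\<lambda>i. xexp s i - core s i) (F - D))"

text \<open>The core can be recovered from its values on \<open>D\<close> and the order, and then
  the excesses give back all exponents. Conversely any admissible data arise, by extending the map
  on \<open>D\<close> with \<open>lowmin\<close> and adding the excesses.\<close>

lemma bij_betw_encode: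
  assumes D: "D \<subseteq> F"
  shows "bij_betw (encode D) {s \<in> covers. core_set s = D}
    (order_pairs D \<times> (F \<rightarrow>\<^sub>E (UNIV :: nat set)) \<times> (F - D \<rightarrow>\<^sub>E {1::nat..}))"
proof (rule bij_betw_imageI)
  show "inj_on (encode D) {s \<in> covers. core_set s = D}"
  proof (rule inj_onI)
    fix s t
    assume st: "s \<in> {s \<in> covers. core_set s = D}" "t \<in> {s \<in> covers. core_set s = D}"
      and eq: "encode D s = encode D t"
    have k: "snd s = snd t" and eqD: "restrict (xexp s) D = restrict (xexp t) D"
      and eqy: "restrict (\<lambda>i. yexp s i - (snd s - core s i)) F = restrict (\<lambda>i. yexp t i - (snd t - core t i)) F"
      and eqx: "restrict (\<lambda>i. xexp s i - core s i) (F - D) = restrict (\<lambda>i. xexp t i - core t i) (F - D)"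
      using eq unfolding encode_def prod.inject by blast+
    have xD: "xexp s i = xexp t i" if "i \<in> D" for i
      using fun_cong[OF eqD, of i] that by simp
    have core: "core s i = core t i" if "i \<in> F" for i
      using core_eq_lowmin_core_set[OF that, of s] core_eq_lowmin_core_set[OF that, of t] st k
        lowmin_cong[of D "xexp s" "xexp t", OF xD] by simp
    have x: "xexp s i = xexp t i" if "i \<in> F" for i
    proof (cases "i \<in> D")
      case False
      then have "xexp s i - core s i = xexp t i - core t i"
        using fun_cong[OF eqx, of i] that by simp
      then show ?thesis
        using core[OF that] core_le(1)[OF that, of s] core_le(1)[OF that, of t] by linarith
    qed (rule xD)
    have "yexp s i = yexp t i" if "i \<in> F" for i
    proof -
      have "yexp s i - (snd s - core s i) = yexp t i - (snd t - core t i)"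
        using fun_cong[OF eqy, of i] that by simp
      then show ?thesis
        using core[OF that] k core_yexp[of s i] core_yexp[of t i] st that by simp
    qed
    then show "s = t"
      using st x k by (intro covers_eqI) auto
  qed
  show "encode D ` {s \<in> covers. core_set s = D} = order_pairs D \<times> (F \<rightarrow>\<^sub>E (UNIV :: nat set)) \<times> (F - D \<rightarrow>\<^sub>E {1::nat..})"
  proof (rule equalityI)
    show "encode D ` {s \<in> covers. core_set s = D} \<subseteq> order_pairs D \<times> (F \<rightarrow>\<^sub>E (UNIV :: nat set)) \<times> (F - D \<rightarrow>\<^sub>E {1::nat..})"
    proof
      fix z assume "z \<in> encode D ` {s \<in> covers. core_set s = D}"
      then obtain s where s: "s \<in> covers" "core_set s = D" "z = encode D s" by blast
      have xD: "xexp s i = core s i" if "i \<in> D" for i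
        using s(2) that by (auto simp: core_set_def)
      have "xexp s j \<le> xexp s i" if "i \<in> D" "j \<in> D" "(p i, p j) \<in> r" for i j
        using core_antimono[of i j s] that D xD by auto
      moreover have "xexp s i \<le> snd s" if "i \<in> D" for i
        using core_le(2)[of s i] xD[OF that] by simp
      ultimately have "(restrict (xexp s) D, snd s) \<in> order_pairs D"
        by (simp add: order_pairs_def order_maps_def PiE_iff)
      moreover have "1 \<le> xexp s i - core s i" if "i \<in> F - D" for i
        using core_le(1)[of i s] s(2) that by (force simp: core_set_def)
      ultimately show "z \<in> order_pairs D \<times> (F \<rightarrow>\<^sub>E (UNIV :: nat set)) \<times> (F - D \<rightarrow>\<^sub>E {1::nat..})"
        by (simp add: s(3) encode_def PiE_iff)
    qed
    show "order_pairs D \<times> (F \<rightarrow>\<^sub>E (UNIV :: nat set)) \<times> (F - D \<rightarrow>\<^sub>E {1::nat..}) \<subseteq> encode D ` {s \<in> covers. core_set s = D}"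
    proof
      fix z assume z: "z \<in> order_pairs D \<times> (F \<rightarrow>\<^sub>E (UNIV :: nat set)) \<times> (F - D \<rightarrow>\<^sub>E {1::nat..})"
      obtain u k e w where zeq: "z = ((u, k), e, w)"
        by (metis surj_pair)
      have u: "u \<in> order_maps p r D k" and e: "e \<in> F \<rightarrow>\<^sub>E UNIV" and w: "w \<in> F - D \<rightarrow>\<^sub>E {1..}"
        using z by (auto simp: zeq order_pairs_def)
      have u_le: "u i \<le> k" if "i \<in> D" for i
        using u that by (auto simp: order_maps_def PiE_iff)
      have u_mono: "u j \<le> u i" if "i \<in> D" "j \<in> D" "(p i, p j) \<in> r" for i j
        using u that by (auto simp: order_maps_def)
      \<comment> \<open>On \<open>F\<close> this is the largest order-reversing extension of
        \<open>u\<close> with values at most \<open>k\<close>; it is to become the core.\<close>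
      define m where "m = lowmin D u k"
      have m_le: "m i \<le> k" for i
        unfolding m_def by (rule lowmin_le_k[OF D])
      have m_mono: "m j \<le> m i" if "i \<in> F" "j \<in> F" "(p i, p j) \<in> r" for i j
        unfolding m_def by (rule lowmin_antimono[OF D that])
      have mD: "m i = u i" if "i \<in> D" for i
      proof (rule antisym)
        show "m i \<le> u i"
          unfolding m_def using that D reflexive by (intro lowmin_le) auto
        show "u i \<le> m i"
          using D unfolding m_def
        proof (cases rule: lowmin_cases[of D u k i])
          case (2 j)
          then show "u i \<le> lowmin D u k i"
            using u_mono[of j i] that by simp
        qed (simp add: u_le that)
      qed
      \<comment> \<open>Off \<open>D\<close> the positive \<open>w i\<close> lifts the exponent
        strictly above the core, which keeps these indices out of the core set; \<open>e i\<close>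
        is the excess over the tight value \<open>k - m i\<close>.\<close>
      let ?a = "\<lambda>i. m i + (if i \<in> D then 0 else w i)" and ?b = "\<lambda>i. (k - m i) + e i"
      let ?s = "(exps ?a ?b, k)"
      have s: "?s \<in> covers"
        unfolding exps_covers_iff
      proof (intro ballI impI)
        fix i j assume ij: "i \<in> F" "j \<in> F" "(p i, p j) \<in> r"
        show "k \<le> ?a i + ?b j"
          using m_mono[OF ij] m_le[of j] by linarith
      qed
      \<comment> \<open>The upper bound comes from the indices in \<open>D\<close>, where the
        exponent is \<open>u\<close> itself; the lower bound holds because all
        \<open>x\<close>-exponents dominate \<open>m\<close> and \<open>m\<close> is
        order-reversing.\<close>
      have core: "core ?s i = m i" if i: "i \<in> F" for i
      proof (rule antisym)
        show "core ?s i \<le> m i"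
          using D
        proof (cases rule: lowmin_cases[of D u k i])
          case 1
          then show ?thesis
            using core_le(2)[of ?s i] by (simp add: m_def)
        next
          case (2 j)
          then have "core ?s i \<le> xexp ?s j"
            unfolding core_def using D by (intro lowmin_le) auto
          also have "\<dots> = u j"
            using 2(1) D mD by (auto simp: lookup_exps)
          finally show ?thesis
            using 2 by (simp add: m_def)
        qed
        show "m i \<le> core ?s i"
          using order_refl[of F]
        proof (cases rule: lowmin_cases[of F "xexp ?s" "snd ?s" i])
          case 1
          then show ?thesis
            using m_le by (simp add: core_def)
        next
          case (2 j)
          then show ?thesis
            using m_mono[OF 2(1) i 2(2)] by (simp add: core_def lookup_exps)
        qed
      qed
      have "core_set ?s = D"
      proof -
        have w0: "i \<in> D" if "i \<in> F" "w i = 0" for i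
          using w that by (force simp: PiE_iff)
        have "i \<in> core_set ?s \<longleftrightarrow> i \<in> D" if "i \<in> F" for i
          using that w0[OF that] core[OF that] by (auto simp: core_set_def lookup_exps)
        then show ?thesis
          using D unfolding core_set_def by blast
      qed
      moreover have "encode D ?s = z"
      proof -
        have "restrict (xexp ?s) D = u"
          using u D mD by (auto simp: fun_eq_iff lookup_exps order_maps_def PiE_iff extensional_def)
        moreover have "restrict (\<lambda>i. yexp ?s i - (k - core ?s i)) F = e"
          using e core by (auto simp: fun_eq_iff lookup_exps PiE_iff extensional_def)
        moreover have "restrict (\<lambda>i. xexp ?s i - core ?s i) (F - D) = w"
          using w core by (auto simp: fun_eq_iff lookup_exps PiE_iff extensional_def)
        ultimately show ?thesis
          by (simp add: encode_def zeq)
      qed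
      ultimately show "z \<in> encode D ` {s \<in> covers. core_set s = D}"
        using s image_eqI[where f = "encode D" and x = ?s and b = z] by simp
    qed
  qed
qed

text \<open>At each index the core cancels: the \<open>x\<close>-excess and the
  \<open>y\<close>-excess add up to the excess of \<open>xexp s i + yexp s i\<close> over the
  order.\<close>

lemma deg_encode:
  assumes "s \<in> {s \<in> covers. core_set s = D}"
  shows "snd (fst (encode D s)) + ((\<Sum>i\<in>F. fst (snd (encode D s)) i) + (\<Sum>i\<in>F - D. snd (snd (encode D s)) i)) = deg s"
proof -
  have D: "D \<subseteq> F"
    using assms by (auto simp: core_set_def)
  have "(\<Sum>i\<in>F - D. snd (snd (encode D s)) i) = (\<Sum>i\<in>F - D. xexp s i - core s i)"
    by (intro sum.cong) (auto simp: encode_def)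
  also have "\<dots> = (\<Sum>i\<in>F. xexp s i - core s i)"
    \<comment> \<open>On \<open>D\<close> the \<open>x\<close>-excess is zero, so the sum may be
      extended to all of \<open>F\<close>.\<close>
    using assms D by (intro sum.mono_neutral_left) (auto simp: core_set_def)
  finally have 1: "(\<Sum>i\<in>F - D. snd (snd (encode D s)) i) = (\<Sum>i\<in>F. xexp s i - core s i)" .
  have 2: "(\<Sum>i\<in>F. fst (snd (encode D s)) i) = (\<Sum>i\<in>F. yexp s i - (snd s - core s i))"
    by (intro sum.cong) (auto simp: encode_def)
  have "(yexp s i - (snd s - core s i)) + (xexp s i - core s i) = xexp s i + yexp s i - snd s" if "i \<in> F" for i
    using core_le(1)[OF that, of s] core_le(2)[of s i] core_yexp[of s i] assms that by auto
  then show ?thesis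
    unfolding 1 2 by (simp add: deg_def encode_def flip: sum.distrib)
qed

lemma genfun_order_pairs:
  assumes "D \<subseteq> F"
  shows "finite_fibers (order_pairs D) snd" "genfun (order_pairs D) snd = order_series p r D"
proof -
  have D: "finite D"
    using assms finite_F by (rule finite_subset)
  have eq: "{z \<in> order_pairs D. snd z = d} = (\<lambda>u. (u, d)) ` order_maps p r D d" for d
    by (auto simp: order_pairs_def)
  show "finite_fibers (order_pairs D) snd"
    unfolding finite_fibers_def eq using finite_order_maps[OF D] by auto
  show "genfun (order_pairs D) snd = order_series p r D"
    unfolding genfun_def order_series_def eq by (simp add: card_image inj_on_def)
qed

text \<open>The three factors count the order-reversing maps on \<open>D\<close>, the arbitrary
  \<open>y\<close>-excesses on \<open>F\<close> and the positive \<open>x\<close>-excesses off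
  \<open>D\<close>.\<close>

lemma genfun_core_set:
  assumes "D \<subseteq> F"
  shows "genfun {s \<in> covers. core_set s = D} deg =
    order_series p r D * ((1 / (1 - fps_X)) ^ card F * (fps_X / (1 - fps_X)) ^ (card F - card D))"
proof -
  let ?E = "F \<rightarrow>\<^sub>E (UNIV :: nat set)" and ?W = "F - D \<rightarrow>\<^sub>E {1::nat..}"
  have E: "finite_fibers ?E (\<lambda>f. \<Sum>i\<in>F. f i)" "genfun ?E (\<lambda>f. \<Sum>i\<in>F. f i) = (1 / (1 - fps_X)) ^ card F"
    using genfun_functions[OF finite_F finite_fibers_nat, of UNIV] by (simp_all add: genfun_UNIV)
  have W: "finite_fibers ?W (\<lambda>f. \<Sum>i\<in>F - D. f i)"
      "genfun ?W (\<lambda>f. \<Sum>i\<in>F - D. f i) = (fps_X / (1 - fps_X)) ^ (card F - card D)"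
    using genfun_functions[of "F - D", OF _ finite_fibers_nat, of "{1..}"] card_Diff_subset[of D F]
      finite_subset[OF assms] assms genfun_positive by simp_all
  note EW = finite_fibers_Times[OF E(1) W(1)]
  have "genfun {s \<in> covers. core_set s = D} deg = genfun (order_pairs D \<times> ?E \<times> ?W)
      (\<lambda>z. snd (fst z) + ((\<Sum>i\<in>F. fst (snd z) i) + (\<Sum>i\<in>F - D. snd (snd z) i)))"
    by (rule genfun_bij_betw[OF bij_betw_encode[OF assms]]) (rule deg_encode)
  also have "\<dots> = order_series p r D * ((1 / (1 - fps_X)) ^ card F * (fps_X / (1 - fps_X)) ^ (card F - card D))"
    unfolding genfun_Times[OF genfun_order_pairs(1)[OF assms] EW] genfun_Times[OF E(1) W(1)]
      genfun_order_pairs(2)[OF assms] E(2) W(2) by (rule refl)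
  finally show ?thesis .
qed

lemma hilbert_A_order_series:
  "hilbert_A TYPE('k::field) G = 1 / (1 - fps_X) ^ card F *
    (\<Sum>D\<in>Pow F. order_series p r D * (fps_X / (1 - fps_X)) ^ (card F - card D))"
proof -
  have "hilbert_A TYPE('k) G = genfun covers deg"
    by (simp add: hilbert_A_eq genfun_def)
  also have "\<dots> = (\<Sum>D\<in>Pow F. genfun {s \<in> covers. core_set s = D} deg)"
    using finite_deg by (intro genfun_partition) (auto simp: finite_fibers_def core_set_def)
  also have "\<dots> = (\<Sum>D\<in>Pow F. (1 / (1 - fps_X)) ^ card F * (order_series p r D * (fps_X / (1 - fps_X)) ^ (card F - card D)))"
    by (rule sum.cong[OF refl]) (simp add: genfun_core_set mult.left_commute)
  also have "\<dots> = (1 / (1 - fps_X)) ^ card F * (\<Sum>D\<in>Pow F. order_series p r D * (fps_X / (1 - fps_X)) ^ (card F - card D))"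
    by (rule sum_distrib_left[symmetric])
  also have "(1 / (1 - fps_X)) ^ card F = (1 / (1 - fps_X) ^ card F :: rat fps)"
  proof -
    have "(1 / (1 - fps_X)) * (1 - fps_X) = (1 :: rat fps)"
      using fps_one_minus_X_nonzero by (simp add: fps_divide_times_eq)
    then have "(1 / (1 - fps_X)) ^ card F * (1 - fps_X) ^ card F = (1 :: rat fps)"
      by (metis power_mult_distrib power_one)
    then show ?thesis
      using fps_one_minus_X_nonzero by (metis nonzero_mult_div_cancel_right power_not_zero)
  qed
  finally show ?thesis .
qed

end

section \<open>From Hilbert series to h-polynomials\<close>

lemma is_h_polynomial_iff:
  assumes "krull_dim R = enat d"
  shows "is_h_polynomial R H h \<longleftrightarrow> H * (1 - fps_X) ^ d = fps_of_poly h"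
proof -
  have nz: "(1 - fps_X) ^ d \<noteq> (0 :: rat fps)"
    using fps_one_minus_X_nonzero by simp
  \<comment> \<open>The constant coefficient of \<open>1 - fps_X\<close> is nonzero, so its powers
    are units and the quotient is an exact division.\<close>
  have dvd: "(1 - fps_X) ^ d dvd (f :: rat fps)" for f
    by (rule unit_imp_dvd) (simp add: fps_is_unit_iff)
  have "is_h_polynomial R H h \<longleftrightarrow> H = fps_of_poly h / (1 - fps_X) ^ d"
    using assms by (auto simp: is_h_polynomial_def)
  also have "\<dots> \<longleftrightarrow> H * (1 - fps_X) ^ d = fps_of_poly h"
    using nz dvd by (metis dvd_div_mult_self nonzero_mult_div_cancel_right)
  finally show ?thesis .
qed

context labelled_poset
begin

lemma h_polynomial_A_iff:
  "h_polynomial_A TYPE('k::field) G h \<longleftrightarrow>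
    hilbert_A TYPE('k) G * (1 - fps_X) ^ (2 * card F + 1) = fps_of_poly h"
  unfolding h_polynomial_A_def by (rule is_h_polynomial_iff[OF krull_dim_A])

lemma h_polynomial_basic_iff:
  "h_polynomial_basic TYPE('k::field) p r F h \<longleftrightarrow>
    order_series p r F * (1 - fps_X) ^ (card F + 1) = fps_of_poly h"
proof (cases "F = {}")
  case True
  \<comment> \<open>The convention prescribes the polynomial 1 here, and the series of the empty
    poset times \<open>1 - fps_X\<close> is 1 as well.\<close>
  have "h = 1 \<longleftrightarrow> fps_of_poly 1 = fps_of_poly h"
    by (auto simp only: fps_of_poly_eq_iff)
  then show ?thesis
    using True order_series_empty[of p r] by (simp add: h_polynomial_basic_def)
next
  case False
  then show ?thesis
    using is_h_polynomial_iff[OF krull_dim_basic]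
    by (simp add: h_polynomial_basic_def hilbert_basic_order_series)
qed

lemma labelled_subposet:
  assumes "D \<subseteq> F"
  shows "labelled_poset p r D"
proof
  show "finite D"
    using assms finite_F by (rule finite_subset)
qed (use reflexive transitive label subsetD[OF assms] in blast)+

text \<open>Of the \<open>2 * card F + 1\<close> factors \<open>1 - fps_X\<close>,
  \<open>card F\<close> cancel the common denominator, \<open>card F - card D\<close> turn the
  powers of \<open>fps_X / (1 - fps_X)\<close> into powers of \<open>fps_X\<close>, and the last
  \<open>card D + 1\<close> clear the series of \<open>D\<close>.\<close>

lemma hilbert_A_clear_denominators:
  "hilbert_A TYPE('k::field) G * (1 - fps_X) ^ (2 * card F + 1) =
    (\<Sum>D\<in>Pow F. order_series p r D * (1 - fps_X) ^ (card D + 1) * fps_X ^ (card F - card D))"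
proof -
  let ?y = "1 - fps_X :: rat fps" and ?n = "card F"
  have X: "fps_X / ?y * ?y = fps_X" and one: "1 / ?y ^ ?n * ?y ^ ?n = 1"
    using fps_one_minus_X_nonzero by (simp_all add: fps_divide_times_eq)
  have summand: "order_series p r D * (fps_X / ?y) ^ (?n - card D) * ?y ^ (?n + 1) =
      order_series p r D * ?y ^ (card D + 1) * fps_X ^ (?n - card D)" if "D \<in> Pow F" for D
  proof -
    have "card D \<le> ?n"
      using that by (auto intro: card_mono)
    then have "?y ^ (?n + 1) = ?y ^ (?n - card D) * ?y ^ (card D + 1)"
      by (simp flip: power_add)
    then have "order_series p r D * (fps_X / ?y) ^ (?n - card D) * ?y ^ (?n + 1) =
        order_series p r D * ?y ^ (card D + 1) * ((fps_X / ?y) ^ (?n - card D) * ?y ^ (?n - card D))"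
      by (simp only: ac_simps)
    also have "(fps_X / ?y) ^ (?n - card D) * ?y ^ (?n - card D) = fps_X ^ (?n - card D)"
      by (simp only: X flip: power_mult_distrib)
    finally show ?thesis .
  qed
  have "?y ^ (2 * ?n + 1) = ?y ^ ?n * ?y ^ (?n + 1)"
    by (simp add: mult_2 flip: power_add)
  then have "hilbert_A TYPE('k) G * ?y ^ (2 * ?n + 1) =
      (1 / ?y ^ ?n * ?y ^ ?n) * ((\<Sum>D\<in>Pow F. order_series p r D * (fps_X / ?y) ^ (?n - card D)) * ?y ^ (?n + 1))"
    unfolding hilbert_A_order_series by (simp only: ac_simps)
  also have "\<dots> = (\<Sum>D\<in>Pow F. order_series p r D * (fps_X / ?y) ^ (?n - card D) * ?y ^ (?n + 1))"
    by (simp only: one mult_1 sum_distrib_right)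
  also have "\<dots> = (\<Sum>D\<in>Pow F. order_series p r D * ?y ^ (card D + 1) * fps_X ^ (?n - card D))"
    by (rule sum.cong[OF refl summand])
  finally show ?thesis .
qed

lemma hilbert_A_h_polynomials:
  assumes "\<And>D. D \<subseteq> F \<Longrightarrow> order_series p r D * (1 - fps_X) ^ (card D + 1) = fps_of_poly (hF D)"
  shows "hilbert_A TYPE('k::field) G * (1 - fps_X) ^ (2 * card F + 1) =
    fps_of_poly (\<Sum>D\<in>Pow F. hF D * [:0, 1:] ^ (card F - card D))"
proof -
  have X: "fps_of_poly [:0, 1:] = (fps_X :: rat fps)"
    by (simp add: fps_of_poly_pCons)
  show ?thesis
    unfolding hilbert_A_clear_denominators fps_of_poly_sum fps_of_poly_mult fps_of_poly_power X
    by (rule sum.cong[OF refl]) (simp only: assms Pow_iff)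
qed

end

theorem theorem3p4:
  fixes n :: nat and p :: "nat \<Rightarrow> 'a" and r :: "'a rel"
  assumes "n \<ge> 1"
    and "inj_on p {1..n}"
    and "partial_order_on (p ` {1..n}) r"
    and "\<And>i j. i \<in> {1..n} \<Longrightarrow> j \<in> {1..n} \<Longrightarrow> (p i, p j) \<in> r \<Longrightarrow> i \<le> j"
  shows
    "hilbert_A TYPE('k::field) (poset_graph p r {1..n}) =
       1 / (1 - fps_X) ^ n *
       (\<Sum>F\<in>Pow {1..n}. hilbert_basic TYPE('k) p r F * (fps_X / (1 - fps_X)) ^ (n - card F))
     \<and> (\<exists>h. h_polynomial_A TYPE('k) (poset_graph p r {1..n}) h)
     \<and> (\<forall>F\<in>Pow {1..n}. \<exists>h. h_polynomial_basic TYPE('k) p r F h)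
     \<and> (\<forall>h hF.
          h_polynomial_A TYPE('k) (poset_graph p r {1..n}) h \<longrightarrow>
          (\<forall>F\<in>Pow {1..n}. h_polynomial_basic TYPE('k) p r F (hF F)) \<longrightarrow>
          h = (\<Sum>F\<in>Pow {1..n}. hF F * [:0, 1:] ^ (n - card F)))"
proof -
  interpret labelled_poset p r "{1..n}"
  proof
    show "(p i, p i) \<in> r" if "i \<in> {1..n}" for i
      using assms(3) that by (auto simp: partial_order_on_def preorder_on_def refl_on_def)
    show "(p i, p l) \<in> r" if "(p i, p j) \<in> r" "(p j, p l) \<in> r" for i j l
      using assms(3) that unfolding partial_order_on_def preorder_on_def by (blast dest: transD)
    show "i \<le> j" if "i \<in> {1..n}" "j \<in> {1..n}" "(p i, p j) \<in> r" for i j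
      using assms(4) that by blast
  qed simp
  \<comment> \<open>Each subset of the index set satisfies the locale assumptions again, so the
    results for the basic cover algebra apply to every \<open>F\<close>.\<close>
  have basic: "hilbert_basic TYPE('k) p r F = order_series p r F"
    "h_polynomial_basic TYPE('k) p r F h \<longleftrightarrow> order_series p r F * (1 - fps_X) ^ (card F + 1) = fps_of_poly h"
    if "F \<subseteq> {1..n}" for F h
    using labelled_poset.hilbert_basic_order_series labelled_poset.h_polynomial_basic_iff labelled_subposet[OF that]
    by blast+
  \<comment> \<open>This yields the existence of all h-polynomials, since the one of
    \<open>A(G)\<close> is assembled from those of the subposets.\<close>
  have rational: "\<exists>h. order_series p r F * (1 - fps_X) ^ (card F + 1) = fps_of_poly h" if "F \<subseteq> {1..n}" for F
    using order_series_rational finite_subset[OF that] by blast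
  then obtain g where g: "\<And>F. F \<subseteq> {1..n} \<Longrightarrow> order_series p r F * (1 - fps_X) ^ (card F + 1) = fps_of_poly (g F)"
    by metis
  have "hilbert_A TYPE('k) (poset_graph p r {1..n}) =
      1 / (1 - fps_X) ^ n *
      (\<Sum>F\<in>Pow {1..n}. hilbert_basic TYPE('k) p r F * (fps_X / (1 - fps_X)) ^ (n - card F))"
    unfolding hilbert_A_order_series by (simp add: basic)
  moreover have "\<exists>h. h_polynomial_A TYPE('k) (poset_graph p r {1..n}) h"
    unfolding h_polynomial_A_iff using hilbert_A_h_polynomials[OF g] by blast
  moreover have "\<forall>F\<in>Pow {1..n}. \<exists>h. h_polynomial_basic TYPE('k) p r F h"
    using rational basic(2) by blast
  moreover have "h = (\<Sum>F\<in>Pow {1..n}. hF F * [:0, 1:] ^ (n - card F))"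
    if "h_polynomial_A TYPE('k) (poset_graph p r {1..n}) h"
      and hF: "\<forall>F\<in>Pow {1..n}. h_polynomial_basic TYPE('k) p r F (hF F)" for h hF
  proof -
    have "order_series p r F * (1 - fps_X) ^ (card F + 1) = fps_of_poly (hF F)" if "F \<subseteq> {1..n}" for F
      using hF basic(2)[OF that] that by blast
    then have "fps_of_poly h = fps_of_poly (\<Sum>F\<in>Pow {1..n}. hF F * [:0, 1:] ^ (card {1..n} - card F))"
      using hilbert_A_h_polynomials[of hF, where 'k = 'k] \<open>h_polynomial_A TYPE('k) (poset_graph p r {1..n}) h\<close>
      unfolding h_polynomial_A_iff by simp
    then show ?thesis
      by (simp add: fps_of_poly_eq_iff)
  qed
  ultimately show ?thesis by blast
qed

end
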